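(* Let $\Gamma$ be a graph and $C=\{v_1,\dots,v_8\}$ a subset of $8$ of its vertices, identified with the eight points of the affine space $\mathrm{AG}(3,2)$, i.e. the vertices of a cube, by $v_1=000$, $v_2=111$, $v_3=101$, $v_4=010$, $v_5=110$, $v_6=001$, $v_7=011$, $v_8=100$. Suppose that: (i) The induced subgraph on $C$ is one of the $40$ graphs $B_1,\dots,B_{40}$ listed in the context. (ii) For every vertex $v$ outside $C$, the set of neighbours of $v$ in $C$ is either $C$, or $\emptyset$, or a set of four vertices forming an affine plane of $\mathrm{AG}(3,2)$. Let $\pi$ be an automorphism of the cube of order six (in other words, a "rotation + complementation"; up to an automorphism of the switching set $C$, the choice of $\pi$ does not matter). Construct $\Gamma'$ from $\Gamma$ on the same vertex set as follows, leaving all other adjacencies unchanged. For every $v$ outside $C$ whose neighbourhood in $C$ is an affine plane $S$, change its neighbourhood in $C$ to: - $\pi(S)$, if $S$ is a face of the cube; - $C\setminus S$, if $S$ is a plane connecting two opposite edges of the cube; - $S$ itself, if $S$ is a set of four pairwise non-adjacent vertices of the cube. If the induced subgraph on $C$ is one of $B_6,\dots,B_{40}$, with adjacency matrix $B$ with respect to the order $v_1,\dots,v_8$, replace it by the graph with adjacency matrix $R_{\mathrm{cube}}^TBR_{\mathrm{cube}}$. Then $\Gamma'$ is $\mathbb{R}$-cospectral with $\Gamma$.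
   Context: Graphs are simple and loopless. Two graphs with adjacency matrices $A$ and $A'$ are $\mathbb{R}$-cospectral if $A+rJ$ and $A'+rJ$ have the same spectrum for every $r\in\mathbb{R}$, where $J$ is the all-ones matrix. The cube has vertex set $\mathbb{F}_2^3$ (written as binary words), two vertices being adjacent when they differ in exactly one coordinate. The 14 affine planes of $\mathrm{AG}(3,2)$ are: the 6 faces of the cube; the 6 planes connecting two opposite edges; and the 2 sets of four pairwise non-adjacent vertices. An automorphism of the cube of order six is an order-three rotation composed with complementation (the antipodal map). $$R_{\mathrm{cube}}=\frac12\begin{bmatrix} -I&I&I&I \\ I&-Z&I&Z \\ I&Z&-Z&I \\ I&I&Z&-Z \end{bmatrix}$$ where $I$, $J$ and $Z=J-I$ are here square matrices of order $2$ ($I$ the identity, $J$ all-ones). The 40 graphs on $\{v_1,\dots,v_8\}$, given by their edges ("$ij$" stands for $v_iv_j$): $B_1$: no edges. $B_2$ (the cube): 14 16 18 23 25 27 36 38 45 47 58 67. $B_3$: 12 34 56 78. $B_4$: 17 18 27 28 35 36 45 46. $B_5$: 12 17 18 27 28 34 35 36 45 46 56 78. $B_6$: 25 26 27 36 38 45 47 48 67 78. $B_7$: 24 25 27 34 36 38 45 48 56 78. $B_8$: 24 25 26 27 34 36 38 45 46 48 67 78. $B_9$: 23 25 27 34 56 78. $B_{10}$: 23 25 27 28 34 38 56 68. $B_{11}$: 23 25 26 27 28 34 38 46 67 68. $B_{12}$: 23 24 25 26 27 28 38 45 46 48 67 68. $B_{13}$: 17 27 28 35 36 38 45 46 58 78.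 $B_{14}$: 17 26 28 35 45 46 47 48 56 67. $B_{15}$: 17 26 27 28 35 38 45 46 56 58 68 78. $B_{16}$: 17 24 25 27 34 36 38 45 47 48 56 57. $B_{17}$: 17 24 25 26 27 34 36 38 45 46 47 48 57 67. $B_{18}$: 17 23 27 28 34 36 37 38 45 46 58 78. $B_{19}$: 17 23 26 28 34 37 45 46 47 48 56 67. $B_{20}$: 17 23 26 27 34 45 46 47 56 57 58 67. $B_{21}$: 17 23 26 27 28 34 37 38 45 46 56 58 68 78. $B_{22}$: 17 23 24 25 37 38 45 47 56 58 68 78. $B_{23}$: 17 23 24 25 27 45 47 48 56 57. $B_{24}$: 17 23 24 25 26 37 38 45 46 47 58 67 68 78. $B_{25}$: 17 23 24 25 26 27 45 46 47 48 57 67. $B_{26}$: 17 23 24 25 26 27 37 38 45 46 58 68. $B_{27}$: 17 23 24 25 26 27 28 37 38 45 46 48 68 78. $B_{28}$: 17 18 24 25 34 36 37 38 45 47 56 68. $B_{29}$: 17 18 24 25 27 34 36 38 45 47 56 57 68 78. $B_{30}$: 17 18 24 25 26 34 36 37 38 45 46 47 67 68. $B_{31}$: 17 18 23 26 28 34 37 45 46 47 56 67 68 78. $B_{32}$: 17 18 23 26 27 28 34 37 45 46 56 68. $B_{33}$: 17 18 23 24 25 37 45 47 56 68. $B_{34}$: 17 18 23 24 25 26 37 45 46 47 67 68. $B_{35}$: 15 18 24 26 34 45 47 48 57 67 68 78. $B_{36}$: 15 18 24 26 27 34 45 48 57 68. $B_{37}$: 15 18 24 25 34 35 36 45 47 48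 67 78. $B_{38}$: 15 18 24 25 28 34 35 36 38 45 47 48 67 68. $B_{39}$: 15 17 18 23 26 27 28 34 35 37 45 46 58 68. $B_{40}$: 14 16 17 23 25 28 35 38 46 47 58 67.
   Formalization: If the induced subgraph is one of B_6,…,B_40, π is required to be the order-six automorphism that the transpose of R_cube induces on the faces of the cube; for other π the claim with this fixed R_cube can fail. For B_1,…,B_5, π is arbitrary. *)

theory Defs
  imports
    "Graph_Theory.Pair_Digraph"
    "Jordan_Normal_Form.Char_Poly"
    "HOL-Combinatorics.Multiset_Permutations"
    "HOL-Library.Z2"
begin

section \<open>Cospectrality\<close>

text \<open>
  A finite simple loopless graph is a value \<open>\<Gamma>\<close> with \<^const>\<open>pair_graph\<close> \<open>\<Gamma>\<close>: a finite
  vertex set \<open>pverts \<Gamma>\<close> and a symmetric irreflexive relation \<open>parcs \<Gamma>\<close> on it.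
\<close>

definition adjacency_mat :: "'a pair_pre_digraph \<Rightarrow> 'a list \<Rightarrow> real mat" where
  "adjacency_mat \<Gamma> xs =
     mat (length xs) (length xs) (\<lambda>(i, j). of_bool ((xs ! i, xs ! j) \<in> parcs \<Gamma>))"

definition all_ones :: "nat \<Rightarrow> real mat" where
  "all_ones n = mat n n (\<lambda>_. 1)"

text \<open>The eigenvalues in \<open>\<complex>\<close>, with algebraic multiplicity.\<close>

definition spectrum_mset :: "real mat \<Rightarrow> complex multiset" where
  "spectrum_mset A = proots (char_poly (map_mat complex_of_real A))"

text \<open>
  \<open>permutations_of_set V\<close> is the set of orderings of \<open>V\<close>. The spectrum does not
  depend on the ordering of the vertices, and we ask for equality for every choice.
\<close>

definition R_cospectral :: "'a pair_pre_digraph \<Rightarrow> 'a pair_pre_digraph \<Rightarrow> bool" where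
  "R_cospectral \<Gamma> \<Gamma>' \<longleftrightarrow>
     (\<forall>xs \<in> permutations_of_set (pverts \<Gamma>). \<forall>ys \<in> permutations_of_set (pverts \<Gamma>').
        \<forall>r::real.
          spectrum_mset (adjacency_mat \<Gamma> xs + r \<cdot>\<^sub>m all_ones (length xs)) =
          spectrum_mset (adjacency_mat \<Gamma>' ys + r \<cdot>\<^sub>m all_ones (length ys)))"


section \<open>The cube and the affine planes of \<open>AG(3,2)\<close>\<close>

type_synonym point = "bit \<times> bit \<times> bit"

fun cube_adj :: "point \<Rightarrow> point \<Rightarrow> bool" where
  "cube_adj (x, y, z) (x', y', z') \<longleftrightarrow>
     of_bool (x \<noteq> x') + of_bool (y \<noteq> y') + of_bool (z \<noteq> z') = (1::nat)"

fun antipode :: "point \<Rightarrow> point" where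
  "antipode (x, y, z) = (x + 1, y + 1, z + 1)"

definition affine_planes :: "point set set" where
  "affine_planes =
     {{(x, y, z). a * x + b * y + c * z = d} | a b c d. (a, b, c) \<noteq> (0, 0, 0)}"

definition faces :: "point set set" where
  "faces = (\<Union>d. {{(x, y, z). x = d}, {(x, y, z). y = d}, {(x, y, z). z = d}})"

text \<open>Two edges of the cube are opposite if they are antipodal images of each other.\<close>

definition edge_planes :: "point set set" where
  "edge_planes = {{q, q', antipode q, antipode q'} | q q'. cube_adj q q'}"

definition nonadjacent_planes :: "point set set" where
  "nonadjacent_planes = {S. card S = 4 \<and> (\<forall>q\<in>S. \<forall>q'\<in>S. \<not> cube_adj q q')}"

definition cube_automorphism :: "(point \<Rightarrow> point) \<Rightarrow> bool" where
  "cube_automorphism \<pi> \<longleftrightarrow>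
     bij \<pi> \<and> (\<forall>q q'. cube_adj (\<pi> q) (\<pi> q') \<longleftrightarrow> cube_adj q q')"

definition order_six_automorphism :: "(point \<Rightarrow> point) \<Rightarrow> bool" where
  "order_six_automorphism \<pi> \<longleftrightarrow>
     cube_automorphism \<pi> \<and> \<pi> ^^ 6 = id \<and> (\<forall>k\<in>{1..5}. \<pi> ^^ k \<noteq> id)"

text \<open>The points identified with \<open>v\<^sub>1, \<dots>, v\<^sub>8\<close>, in this order; list positions start at 0.\<close>

definition points :: "point list" where
  "points = [(0,0,0), (1,1,1), (1,0,1), (0,1,0), (1,1,0), (0,0,1), (0,1,1), (1,0,0)]"


section \<open>The matrix \<open>R\<^sub>c\<^sub>u\<^sub>b\<^sub>e\<close> and the graphs \<open>B\<^sub>1, \<dots>, B\<^sub>4\<^sub>0\<close>\<close>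

definition R_cube :: "real mat" where
  "R_cube =
     (let I = 1\<^sub>m 2; Z = all_ones 2 - I;
          blocks = [[-I,  I,  I,  I],
                    [ I, -Z,  I,  Z],
                    [ I,  Z, -Z,  I],
                    [ I,  I,  Z, -Z]]
      in mat 8 8 (\<lambda>(i, j).
           1 / 2 * (blocks ! (i div 2) ! (j div 2)) $$ (i mod 2, j mod 2)))"

text \<open>The two-digit number \<open>10 * i + j\<close> stands for the edge \<open>v\<^sub>i v\<^sub>j\<close>.\<close>

definition B_edges :: "nat list list" where
  "B_edges =
  [[],
   [14, 16, 18, 23, 25, 27, 36, 38, 45, 47, 58, 67],
   [12, 34, 56, 78],
   [17, 18, 27, 28, 35, 36, 45, 46],
   [12, 17, 18, 27, 28, 34, 35, 36, 45, 46, 56, 78],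
   [25, 26, 27, 36, 38, 45, 47, 48, 67, 78],
   [24, 25, 27, 34, 36, 38, 45, 48, 56, 78],
   [24, 25, 26, 27, 34, 36, 38, 45, 46, 48, 67, 78],
   [23, 25, 27, 34, 56, 78],
   [23, 25, 27, 28, 34, 38, 56, 68],
   [23, 25, 26, 27, 28, 34, 38, 46, 67, 68],
   [23, 24, 25, 26, 27, 28, 38, 45, 46, 48, 67, 68],
   [17, 27, 28, 35, 36, 38, 45, 46, 58, 78],
   [17, 26, 28, 35, 45, 46, 47, 48, 56, 67],
   [17, 26, 27, 28, 35, 38, 45, 46, 56, 58, 68, 78],
   [17, 24, 25, 27, 34, 36, 38, 45, 47, 48, 56, 57],
   [17, 24, 25, 26, 27, 34, 36, 38, 45, 46, 47, 48, 57, 67],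
   [17, 23, 27, 28, 34, 36, 37, 38, 45, 46, 58, 78],
   [17, 23, 26, 28, 34, 37, 45, 46, 47, 48, 56, 67],
   [17, 23, 26, 27, 34, 45, 46, 47, 56, 57, 58, 67],
   [17, 23, 26, 27, 28, 34, 37, 38, 45, 46, 56, 58, 68, 78],
   [17, 23, 24, 25, 37, 38, 45, 47, 56, 58, 68, 78],
   [17, 23, 24, 25, 27, 45, 47, 48, 56, 57],
   [17, 23, 24, 25, 26, 37, 38, 45, 46, 47, 58, 67, 68, 78],
   [17, 23, 24, 25, 26, 27, 45, 46, 47, 48, 57, 67],
   [17, 23, 24, 25, 26, 27, 37, 38, 45, 46, 58, 68],
   [17, 23, 24, 25, 26, 27, 28, 37, 38, 45, 46, 48, 68, 78],
   [17, 18, 24, 25, 34, 36, 37, 38, 45, 47, 56, 68],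
   [17, 18, 24, 25, 27, 34, 36, 38, 45, 47, 56, 57, 68, 78],
   [17, 18, 24, 25, 26, 34, 36, 37, 38, 45, 46, 47, 67, 68],
   [17, 18, 23, 26, 28, 34, 37, 45, 46, 47, 56, 67, 68, 78],
   [17, 18, 23, 26, 27, 28, 34, 37, 45, 46, 56, 68],
   [17, 18, 23, 24, 25, 37, 45, 47, 56, 68],
   [17, 18, 23, 24, 25, 26, 37, 45, 46, 47, 67, 68],
   [15, 18, 24, 26, 34, 45, 47, 48, 57, 67, 68, 78],
   [15, 18, 24, 26, 27, 34, 45, 48, 57, 68],
   [15, 18, 24, 25, 34, 35, 36, 45, 47, 48, 67, 78],
   [15, 18, 24, 25, 28, 34, 35, 36, 38, 45, 47, 48, 67, 68],
   [15, 17, 18, 23, 26, 27, 28, 34, 35, 37, 45, 46, 58, 68],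
   [14, 16, 17, 23, 25, 28, 35, 38, 46, 47, 58, 67]]"

definition B_mat :: "nat \<Rightarrow> real mat" where
  "B_mat k = mat 8 8 (\<lambda>(i, j).
     of_bool (10 * (i + 1) + (j + 1) \<in> set (B_edges ! (k - 1)) \<or>
              10 * (j + 1) + (i + 1) \<in> set (B_edges ! (k - 1))))"


section \<open>Compatibility of \<open>\<pi>\<close> with \<open>R\<^sub>c\<^sub>u\<^sub>b\<^sub>e\<close>\<close>

definition char_vec :: "point set \<Rightarrow> real vec" where
  "char_vec S = vec 8 (\<lambda>i. of_bool (points ! i \<in> S))"

text \<open>
  \<open>R\<^sub>c\<^sub>u\<^sub>b\<^sub>e\<close> is tied to the coordinates: its transpose permutes the characteristic vectors of
  the faces as exactly one of the eight order-six automorphisms does. The other seven are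
  conjugate to that one and belong to the matrices obtained from \<open>R\<^sub>c\<^sub>u\<^sub>b\<^sub>e\<close> by relabelling
  the points with an automorphism of the cube.
\<close>

definition realised_by_R_cube :: "(point \<Rightarrow> point) \<Rightarrow> bool" where
  "realised_by_R_cube \<pi> \<longleftrightarrow>
     (\<forall>F\<in>faces. transpose_mat R_cube *\<^sub>v char_vec F = char_vec (\<pi> ` F))"


section \<open>The switching\<close>

text \<open>
  The set \<open>C\<close> and its identification with the points of \<open>AG(3,2)\<close> are given by an
  injection \<open>p\<close> of the points into the vertices: \<open>C = range p\<close>, and \<open>v\<^sub>i\<close> is the image of
  the \<open>i\<close>-th entry of \<open>points\<close>. Neighbourhoods in \<open>C\<close> are given as sets of points.
\<close>

definition nbhd :: "'a pair_pre_digraph \<Rightarrow> (point \<Rightarrow> 'a) \<Rightarrow> 'a \<Rightarrow> point set" where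
  "nbhd \<Gamma> p v = {q. (v, p q) \<in> parcs \<Gamma>}"

text \<open>
  The last case covers the planes of four pairwise non-adjacent points as well as the
  neighbourhoods \<open>{}\<close> and \<open>UNIV\<close>.
\<close>

definition switched_nbhd :: "(point \<Rightarrow> point) \<Rightarrow> point set \<Rightarrow> point set" where
  "switched_nbhd \<pi> S =
     (if S \<in> faces then \<pi> ` S else if S \<in> edge_planes then UNIV - S else S)"

definition switched_B :: "real mat \<Rightarrow> real mat" where
  "switched_B M = (if \<exists>k\<in>{6..40}. M = B_mat k then transpose_mat R_cube * M * R_cube else M)"

text \<open>
  The edges inside \<open>C\<close> are the entries 1 of the new matrix. That this matrix is the
  adjacency matrix of a graph is not built in; it has to be claimed separately.
\<close>

definition switch ::
  "'a pair_pre_digraph \<Rightarrow> (point \<Rightarrow> 'a) \<Rightarrow> (point \<Rightarrow> point) \<Rightarrow> 'a pair_pre_digraph" where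
  "switch \<Gamma> p \<pi> =
     \<lparr> pverts = pverts \<Gamma>,
       parcs =
         {(u, v) \<in> parcs \<Gamma>. u \<notin> range p \<and> v \<notin> range p}
         \<union> {(v, p q) | v q. v \<in> pverts \<Gamma> - range p \<and> q \<in> switched_nbhd \<pi> (nbhd \<Gamma> p v)}
         \<union> {(p q, v) | v q. v \<in> pverts \<Gamma> - range p \<and> q \<in> switched_nbhd \<pi> (nbhd \<Gamma> p v)}
         \<union> {(p (points ! i), p (points ! j)) | i j. i < 8 \<and> j < 8 \<and>
              switched_B (adjacency_mat \<Gamma> (map p points)) $$ (i, j) = 1} \<rparr>"


section \<open>Consistency checks\<close>

lemma UNIV_point: "(UNIV :: point set) = set points"
proof -
  have "(x, y, z) \<in> set points" for x y z
    by (cases x; cases y; cases z) (simp_all add: points_def)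
  then show ?thesis by auto
qed

lemma mem_points: "q \<in> set points"
  by (simp flip: UNIV_point)

lemma Collect_point: "Collect P = set (filter P points)"
  by (simp add: mem_points)

lemma faces_code: "faces =
  set (map (\<lambda>P. set (filter P points))
   [\<lambda>(x,y,z). x = 0, \<lambda>(x,y,z). x = 1, \<lambda>(x,y,z). y = 0, \<lambda>(x,y,z). y = 1, \<lambda>(x,y,z). z = 0, \<lambda>(x,y,z). z = 1])"
proof -
  have *: "(UNIV :: bit set) = {0, 1}" by auto
  show ?thesis unfolding faces_def Collect_point * by auto
qed

lemma edge_planes_code: "edge_planes =
  set (concat (map (\<lambda>q. map (\<lambda>q'. {q, q', antipode q, antipode q'}) (filter (cube_adj q) points)) points))"
proof -
  have "edge_planes =
    (\<Union>q\<in>UNIV. (\<lambda>q'. {q, q', antipode q, antipode q'}) ` {q'. cube_adj q q'})"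
    unfolding edge_planes_def by blast
  then show ?thesis
    unfolding UNIV_point Collect_point by (simp only: set_concat set_map image_image)
qed

lemma nonadjacent_planes_code: "nonadjacent_planes =
  set [{(0,0,0), (0,1,1), (1,0,1), (1,1,0)}, {(1,1,1), (1,0,0), (0,1,0), (0,0,1)}]"
proof -
  let ?E = "{(0,0,0), (0,1,1), (1,0,1), (1,1,0)} :: point set"
  let ?O = "{(1,1,1), (1,0,0), (0,1,0), (0,0,1)} :: point set"
  have EO: "q \<in> ?E \<or> q \<in> ?O" for q :: point
    by (cases q; cases "fst q"; cases "fst (snd q)"; cases "snd (snd q)") simp_all
  have "\<forall>q\<in>set [(0,0,0), (0,1,1), (1,0,1), (1,1,0)].
        \<forall>q'\<in>set [(1,1,1), (1,0,0), (0,1,0), (0,0,1)].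
        \<forall>x\<in>set points. x = q \<or> x = q' \<or> cube_adj q q' \<or> cube_adj q x \<or> cube_adj q' x"
    by code_simp
  then have adj: "x = q \<or> x = q' \<or> cube_adj q q' \<or> cube_adj q x \<or> cube_adj q' x"
    if "q \<in> ?E" "q' \<in> ?O" for q q' x
    using that mem_points[of x] by (simp only: list.set)
  have sub: "S = ?E \<or> S = ?O" if S: "card S = 4" "\<forall>q\<in>S. \<forall>q'\<in>S. \<not> cube_adj q q'" for S
  proof -
    have "S \<subseteq> ?E \<or> S \<subseteq> ?O"
    proof (rule ccontr)
      assume "\<not> (S \<subseteq> ?E \<or> S \<subseteq> ?O)"
      then obtain q q' where q: "q \<in> S" "q \<in> ?E" "q' \<in> S" "q' \<in> ?O"
        using EO by (meson subsetI)
      have "x = q \<or> x = q'" if "x \<in> S" for x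
        using adj[OF q(2,4), of x] S(2) q(1,3) that by metis
      then have "S \<subseteq> {q, q'}" by blast
      then have "card S \<le> card {q, q'}" by (intro card_mono) auto
      also have "\<dots> \<le> 2" by (simp add: card_insert_if)
      finally show False using S(1) by simp
    qed
    moreover have "S = ?E" if "S \<subseteq> ?E"
      using card_subset_eq[of ?E S] S(1) that by simp
    moreover have "S = ?O" if "S \<subseteq> ?O"
      using card_subset_eq[of ?O S] S(1) that by simp
    ultimately show ?thesis by argo
  qed
  have sup: "card S = 4 \<and> (\<forall>q\<in>S. \<forall>q'\<in>S. \<not> cube_adj q q')" if "S = ?E \<or> S = ?O" for S
    using that by (elim disjE; hypsubst; simp)
  have two: "{S. P S} = set [a, b]"
    if "\<And>S. P S \<Longrightarrow> S = a \<or> S = b" "P a" "P b" for P and a b :: "point set"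
    using that by auto
  show ?thesis
    unfolding nonadjacent_planes_def
  proof (rule two)
    show "S = ?E \<or> S = ?O" if "card S = 4 \<and> (\<forall>q\<in>S. \<forall>q'\<in>S. \<not> cube_adj q q')" for S
      by (rule sub[OF that[THEN conjunct1] that[THEN conjunct2]])
  qed (rule sup, rule disjI1, rule refl, rule sup, rule disjI2, rule refl)
qed

lemma affine_planes_code: "affine_planes =
  set (concat (map (\<lambda>(a,b,c). map (\<lambda>d. set (filter (\<lambda>(x,y,z). a * x + b * y + c * z = d) points)) [0,1])
    (filter (\<lambda>q. q \<noteq> (0,0,0)) points)))"
proof -
  have *: "(UNIV :: bit set) = {0, 1}" by auto
  have "affine_planes = (\<Union>q\<in>{q. q \<noteq> (0,0,0)}. case q of (a,b,c) \<Rightarrow>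
      (\<lambda>d. {(x,y,z). a * x + b * y + c * z = d}) ` UNIV)"
    unfolding affine_planes_def
    by (simp only: full_SetCompr_eq set_eq_iff UN_iff mem_Collect_eq
          split_paired_Ex split_paired_all prod.case image_iff) blast
  also have "\<dots> = set (concat (map (\<lambda>(a,b,c). map (\<lambda>d. set (filter (\<lambda>(x,y,z). a * x + b * y + c * z = d) points)) [0,1])
    (filter (\<lambda>q. q \<noteq> (0,0,0)) points)))"
    unfolding Collect_point * by (simp add: split_def)
  finally show ?thesis .
qed

lemma card_faces: "card faces = 6"
  unfolding faces_code by code_simp

lemma card_edge_planes: "card edge_planes = 6"
  unfolding edge_planes_code by code_simp

lemma card_nonadjacent_planes: "card nonadjacent_planes = 2"
  unfolding nonadjacent_planes_code by code_simp

lemma card_affine_planes: "card affine_planes = 14"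
  unfolding affine_planes_code by code_simp

lemma affine_planes_eq: "affine_planes = faces \<union> edge_planes \<union> nonadjacent_planes"
  unfolding faces_code edge_planes_code nonadjacent_planes_code affine_planes_code
  by code_simp

lemma order_six_example: "order_six_automorphism (\<lambda>(x, y, z). (y + 1, z + 1, x + 1))"
  (is "order_six_automorphism ?p")
proof -
  have powers:
    "(?p ^^ 1) q = ?p q" "(?p ^^ 2) q = ?p (?p q)" "(?p ^^ 3) q = ?p (?p (?p q))"
    "(?p ^^ 4) q = ?p (?p (?p (?p q)))" "(?p ^^ 5) q = ?p (?p (?p (?p (?p q))))"
    "(?p ^^ 6) q = ?p (?p (?p (?p (?p (?p q)))))" for q
    by (simp_all only: numeral_eq_Suc pred_numeral_simps BitM.simps
          funpow.simps comp_apply id_apply One_nat_def arith_simps)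
  have six: "?p ^^ 6 = id"
  proof
    show "(?p ^^ 6) q = id q" for q unfolding powers by (cases q) (simp add: add.assoc)
  qed
  have "(?p ^^ k) (0, 0, 1) \<noteq> (0, 0, 1)" if "k \<in> {1..5}" for k
  proof -
    from that have "k = 1 \<or> k = 2 \<or> k = 3 \<or> k = 4 \<or> k = 5" by auto
    then show ?thesis by (elim disjE; hypsubst; unfold powers; simp)
  qed
  then have "\<forall>k\<in>{1..5}. ?p ^^ k \<noteq> id" by (metis id_apply)
  moreover have "bij ?p"
    by (rule o_bij[where g = "\<lambda>(x, y, z). (z + 1, x + 1, y + 1)"]) (auto simp: fun_eq_iff add.assoc)
  moreover have "cube_adj (?p q) (?p q') \<longleftrightarrow> cube_adj q q'" for q q'
    by (cases q; cases q') (simp add: add.assoc ac_simps)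
  ultimately show ?thesis
    unfolding order_six_automorphism_def cube_automorphism_def using six by blast
qed

definition R_rows :: "real list list" where "R_rows = [
  [-1,0,1,0,1,0,1,0],
  [0,-1,0,1,0,1,0,1],
  [1,0,0,-1,1,0,0,1],
  [0,1,-1,0,0,1,1,0],
  [1,0,0,1,0,-1,1,0],
  [0,1,1,0,-1,0,0,1],
  [1,0,1,0,0,1,0,-1],
  [0,1,0,1,1,0,-1,0]]"

lemma less_eight_iff: "i < 8 \<longleftrightarrow> i = 0 \<or> i = 1 \<or> i = 2 \<or> i = 3 \<or> i = 4 \<or> i = 5 \<or> i = 6 \<or> i = (7::nat)"
  by auto

lemma R_cube_entries: "R_cube = mat 8 8 (\<lambda>(i, j). R_rows ! i ! j / 2)"
proof (rule eq_matI)
  fix i j :: nat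
  assume "i < dim_row (mat 8 8 (\<lambda>(i, j). R_rows ! i ! j / 2))" "j < dim_col (mat 8 8 (\<lambda>(i, j). R_rows ! i ! j / 2))"
  then have i: "i < 8" and j: "j < 8" by auto
  then have *: "R_cube $$ (i,j) = (let I = 1\<^sub>m 2; Z = all_ones 2 - I;
          blocks = [[-I,  I,  I,  I],
                    [ I, -Z,  I,  Z],
                    [ I,  Z, -Z,  I],
                    [ I,  I,  Z, -Z]] in
           1 / 2 * (blocks ! (i div 2) ! (j div 2)) $$ (i mod 2, j mod 2))"
    by (simp add: R_cube_def Let_def)
  have **: "mat 8 8 (\<lambda>(i, j). R_rows ! i ! j / 2) $$ (i,j) = R_rows ! i ! j / 2"
    using i j by simp
  from i j show "R_cube $$ (i,j) = mat 8 8 (\<lambda>(i, j). R_rows ! i ! j / 2) $$ (i,j)"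
    unfolding * ** less_eight_iff Let_def R_rows_def all_ones_def
    by (elim disjE; hypsubst; simp)
qed (auto simp: R_cube_def Let_def)

lemma transpose_R_cube_mult_char_vec:
  assumes "\<And>j. j < 8 \<Longrightarrow> (\<Sum>i<8. R_rows ! i ! j * of_bool (points ! i \<in> F)) = 2 * of_bool (points ! j \<in> G)"
  shows "transpose_mat R_cube *\<^sub>v char_vec F = char_vec G"
proof (rule eq_vecI)
  fix j assume "j < dim_vec (char_vec G)"
  then have j: "j < 8" by (simp add: char_vec_def)
  have "(transpose_mat R_cube *\<^sub>v char_vec F) $ j = (\<Sum>i<8. R_rows ! i ! j / 2 * of_bool (points ! i \<in> F))"
    using j by (simp add: R_cube_entries char_vec_def scalar_prod_def lessThan_atLeast0)
  also have "\<dots> = (\<Sum>i<8. R_rows ! i ! j * of_bool (points ! i \<in> F)) / 2"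
    unfolding sum_divide_distrib by (rule sum.cong) simp_all
  also have "\<dots> = of_bool (points ! j \<in> G)" using assms[OF j] by auto
  finally show "(transpose_mat R_cube *\<^sub>v char_vec F) $ j = char_vec G $ j"
    using j by (simp add: char_vec_def)
qed (auto simp: R_cube_entries char_vec_def)

lemma image_eq_Collect_inverse:
  assumes "\<And>q. f (g q) = q" "\<And>q. g (f q) = q"
  shows "f ` S = {q. g q \<in> S}"
  using assms by (auto simp: image_iff) metis

lemma realised_example: "realised_by_R_cube (\<lambda>(x, y, z). (y + 1, z + 1, x + 1))"
  (is "realised_by_R_cube ?p")
proof -
  have U: "(UNIV :: bit set) = {0, 1}" by auto
  have inv: "?p ((\<lambda>(x, y, z). (z + 1, x + 1, y + 1)) q) = q"
    "(\<lambda>(x, y, z). (z + 1, x + 1, y + 1)) (?p q) = q" for q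
    by (auto split: prod.splits simp: add.assoc)
  then have I: "?p ` S = {q. (\<lambda>(x, y, z). (z + 1, x + 1, y + 1)) q \<in> S}" for S
    by (rule image_eq_Collect_inverse)
  have s: "(\<Sum>i<8. f i) = f 0 + f 1 + f 2 + f 3 + f 4 + f 5 + f 6 + f 7" for f :: "nat \<Rightarrow> real"
    by (simp add: numeral_eq_Suc)
  show ?thesis unfolding realised_by_R_cube_def faces_def U I
    by (simp, intro conjI; rule transpose_R_cube_mult_char_vec;
        unfold s less_eight_iff points_def R_rows_def; elim disjE; hypsubst; simp)
qed

end

theory Submission
  imports Defs
begin

text \<open>
  Extend \<open>R\<^sub>c\<^sub>u\<^sub>b\<^sub>e\<close> by the identity on the vertices outside \<open>C\<close>. The result is an orthogonal matrix
  with all column sums 1, so conjugation by it preserves \<open>J\<close> and the spectrum of every \<open>A + r J\<close>.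
  It maps the characteristic vector of each admissible neighbourhood to that of the switched
  neighbourhood, as long as \<open>\<pi>\<close> is the automorphism realised by \<open>R\<^sub>c\<^sub>u\<^sub>b\<^sub>e\<close>.

  For \<open>B\<^sub>1, \<dots>, B\<^sub>5\<close>, which \<open>R\<^sub>c\<^sub>u\<^sub>b\<^sub>e\<close> fixes, \<open>\<pi>\<close> is arbitrary. It is conjugate to the realised
  automorphism by a symmetry \<open>\<tau>\<close> of the cube that preserves \<open>B\<^sub>1, \<dots>, B\<^sub>5\<close>, and relabelling
  \<open>C\<close> by \<open>\<tau>\<close> reduces this case to the previous one.
\<close>

section \<open>Switching with an orthogonal matrix\<close>

lemma sum_nth_permutation:
  assumes "xs \<in> permutations_of_set V"
  shows "(\<Sum>i<length xs. f (xs ! i)) = sum f V"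
proof -
  have "bij_betw ((!) xs) {..<length xs} V"
    using assms by (intro bij_betw_nth) (auto dest: permutations_of_setD)
  then show ?thesis by (rule sum.reindex_bij_betw)
qed

text \<open>In the change of basis the rows follow \<open>xs\<close> and the columns follow
  \<open>ys\<close>, so one conjugation also absorbs the change of ordering. Writing everything as
  functions on \<open>V\<close> keeps the two orderings out of the hypotheses.\<close>

lemma char_poly_eq_if_orthogonal_conj:
  fixes W f g :: "'a \<Rightarrow> 'a \<Rightarrow> 'b::field"
  assumes xs: "xs \<in> permutations_of_set V" and ys: "ys \<in> permutations_of_set V"
    and orth: "\<And>x y. x \<in> V \<Longrightarrow> y \<in> V \<Longrightarrow> (\<Sum>u\<in>V. W u x * W u y) = of_bool (x = y)"
    and conj: "\<And>x y. x \<in> V \<Longrightarrow> y \<in> V \<Longrightarrow> (\<Sum>u\<in>V. W u x * (\<Sum>v\<in>V. f u v * W v y)) = g x y"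
  shows "char_poly (mat (length xs) (length xs) (\<lambda>(i, j). f (xs ! i) (xs ! j))) =
         char_poly (mat (length ys) (length ys) (\<lambda>(i, j). g (ys ! i) (ys ! j)))"
proof -
  have [simp]: "length ys = length xs"
    using length_finite_permutations_of_set[OF xs] length_finite_permutations_of_set[OF ys] by simp
  let ?n = "length xs"
  define P where "P = mat ?n ?n (\<lambda>(i, j). W (xs ! i) (ys ! j))"
  let ?F = "mat ?n ?n (\<lambda>(i, j). f (xs ! i) (xs ! j))"
  let ?G = "mat ?n ?n (\<lambda>(i, j). g (ys ! i) (ys ! j))"
  have P: "P \<in> carrier_mat ?n ?n" by (simp add: P_def)
  have dist: "distinct ys" and mem: "\<And>i. i < ?n \<Longrightarrow> ys ! i \<in> V"
    using permutations_of_setD[OF ys] nth_mem[of _ ys] by auto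
  have "transpose_mat P * P = 1\<^sub>m ?n"
  proof (rule eq_matI)
    fix i j assume "i < dim_row (1\<^sub>m ?n)" "j < dim_col (1\<^sub>m ?n)"
    then have ij: "i < ?n" "j < ?n" by auto
    then have "(transpose_mat P * P) $$ (i, j) = (\<Sum>k<?n. W (xs ! k) (ys ! i) * W (xs ! k) (ys ! j))"
      by (simp add: P_def scalar_prod_def lessThan_atLeast0)
    also have "\<dots> = of_bool (ys ! i = ys ! j)"
      using orth mem ij by (subst sum_nth_permutation[OF xs, of "\<lambda>u. W u (ys ! i) * W u (ys ! j)"]) simp
    finally show "(transpose_mat P * P) $$ (i, j) = 1\<^sub>m ?n $$ (i, j)"
      using ij dist by (simp add: nth_eq_iff_index_eq)
  qed (auto simp: P_def)
  moreover from this have "P * transpose_mat P = 1\<^sub>m ?n"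
    by (intro mat_mult_left_right_inverse[of "transpose_mat P"]) (use P in auto)
  moreover have "?G = transpose_mat P * ?F * P"
  proof (rule eq_matI)
    fix i j assume "i < dim_row (transpose_mat P * ?F * P)" "j < dim_col (transpose_mat P * ?F * P)"
    then have ij: "i < ?n" "j < ?n" by (auto simp: P_def)
    have "transpose_mat P * ?F * P = transpose_mat P * (?F * P)"
      using P by (intro assoc_mult_mat[of _ ?n ?n _ ?n _ ?n]) auto
    then have "(transpose_mat P * ?F * P) $$ (i, j) =
        (\<Sum>k<?n. W (xs ! k) (ys ! i) * (\<Sum>l<?n. f (xs ! k) (xs ! l) * W (xs ! l) (ys ! j)))"
      using ij by (simp add: P_def scalar_prod_def lessThan_atLeast0)
    also have "\<dots> = g (ys ! i) (ys ! j)"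
      using conj mem ij
      by (simp add: sum_nth_permutation[OF xs, of "\<lambda>v. f u v * W v y" for u y]
          sum_nth_permutation[OF xs, of "\<lambda>u. W u x * (\<Sum>v\<in>V. f u v * W v y)" for x y])
    finally show "?G $$ (i, j) = (transpose_mat P * ?F * P) $$ (i, j)"
      using ij by simp
  qed (auto simp: P_def)
  ultimately have "similar_mat ?G ?F"
    using P by (intro similar_matI[of _ _ "transpose_mat P" P ?n]) auto
  then show ?thesis by (simp add: char_poly_similar)
qed

text \<open>Taking characteristic polynomials commutes with the embedding of the reals into the
  complex numbers.\<close>

lemma spectrum_mset_cong:
  assumes "A \<in> carrier_mat n n" "B \<in> carrier_mat m m" "char_poly A = char_poly B"
  shows "spectrum_mset A = spectrum_mset B"
  unfolding spectrum_mset_def of_real_hom.char_poly_hom[OF assms(1)]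
    of_real_hom.char_poly_hom[OF assms(2)] assms(3) ..

text \<open>\<open>inner\<close>, \<open>mixed\<close> and \<open>outer\<close> give three blocks of
  the identity that conjugates one adjacency matrix into the other; the symmetry of both graphs
  supplies the fourth.\<close>

lemma R_cospectral_switching:
  fixes p :: "'b \<Rightarrow> 'a" and Q :: "'b \<Rightarrow> 'b \<Rightarrow> real"
  assumes inj: "inj p" and C: "range p \<subseteq> pverts \<Gamma>"
    and verts: "pverts \<Gamma>' = pverts \<Gamma>"
    and sym: "sym (parcs \<Gamma>)" and sym': "sym (parcs \<Gamma>')"
    and orth: "\<And>a b. (\<Sum>c\<in>UNIV. Q c a * Q c b) = of_bool (a = b)"
    and ones: "\<And>b. (\<Sum>c\<in>UNIV. Q c b) = 1"
    and inner: "\<And>a b. (\<Sum>c\<in>UNIV. Q c a * (\<Sum>d\<in>UNIV. of_bool ((p c, p d) \<in> parcs \<Gamma>) * Q d b))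
        = of_bool ((p a, p b) \<in> parcs \<Gamma>')"
    and mixed: "\<And>v b. v \<in> pverts \<Gamma> - range p \<Longrightarrow>
        (\<Sum>c\<in>UNIV. of_bool ((v, p c) \<in> parcs \<Gamma>) * Q c b) = of_bool ((v, p b) \<in> parcs \<Gamma>')"
    and outer: "\<And>u v. u \<in> pverts \<Gamma> - range p \<Longrightarrow> v \<in> pverts \<Gamma> - range p \<Longrightarrow>
        (u, v) \<in> parcs \<Gamma>' \<longleftrightarrow> (u, v) \<in> parcs \<Gamma>"
  shows "R_cospectral \<Gamma> \<Gamma>'"
proof (cases "finite (pverts \<Gamma>)")
  case False
  \<comment> \<open>An infinite vertex set has no orderings, so the quantifiers range over the empty
    set.\<close>
  then show ?thesis
    by (simp add: R_cospectral_def permutations_of_set_infinite)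
next
  case fin: True
  let ?V = "pverts \<Gamma>"
  \<comment> \<open>The block matrix: \<open>Q\<close>, read through the labelling \<open>p\<close>,
    on C and the identity outside, with zeros between the two parts.\<close>
  define W where "W = (\<lambda>u v. if u \<in> range p \<and> v \<in> range p
    then Q (inv_into UNIV p u) (inv_into UNIV p v) else of_bool (u = v))"
  have W_inner: "(\<Sum>u\<in>?V. h u * W u (p b)) = (\<Sum>c\<in>UNIV. h (p c) * Q c b)" for h b
  proof -
    have "(\<Sum>u\<in>?V. h u * W u (p b)) = (\<Sum>u\<in>range p. h u * W u (p b))"
      using C fin by (intro sum.mono_neutral_right) (auto simp: W_def)
    also have "\<dots> = (\<Sum>c\<in>UNIV. h (p c) * Q c b)"
      using inj by (simp add: sum.reindex W_def)
    finally show ?thesis .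
  qed
  have W_outer: "(\<Sum>u\<in>?V. h u * W u v) = h v" if "v \<in> ?V - range p" for h v
  proof -
    have "(\<Sum>u\<in>?V. h u * W u v) = (\<Sum>u\<in>{v}. h u * W u v)"
      using that fin by (intro sum.mono_neutral_right) (auto simp: W_def)
    then show ?thesis using that by (simp add: W_def)
  qed
  have W_outer_inner: "W v (p b) = 0" if "v \<notin> range p" for v b
    using that by (auto simp: W_def)
  have W_id: "W u v = of_bool (u = v)" if "v \<notin> range p" for u v
    using that by (simp add: W_def)
  have W_Q: "W (p a) (p b) = Q a b" for a b
    using inj by (simp add: W_def)
  have "spectrum_mset (adjacency_mat \<Gamma> xs + r \<cdot>\<^sub>m all_ones (length xs)) =
        spectrum_mset (adjacency_mat \<Gamma>' ys + r \<cdot>\<^sub>m all_ones (length ys))"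
    if xs: "xs \<in> permutations_of_set ?V" and ys: "ys \<in> permutations_of_set ?V" for xs ys r
  proof -
    \<comment> \<open>The summand r J is absorbed into the entries, so that a single conjugation
      identity treats the whole matrix.\<close>
    define f :: "'a pair_pre_digraph \<Rightarrow> 'a \<Rightarrow> 'a \<Rightarrow> real"
      where "f \<Delta> u v = of_bool ((u, v) \<in> parcs \<Delta>) + r" for \<Delta> u v
    have mat: "adjacency_mat \<Delta> xs + r \<cdot>\<^sub>m all_ones (length xs) =
      mat (length xs) (length xs) (\<lambda>(i, j). f \<Delta> (xs ! i) (xs ! j))" for \<Delta> and xs :: "'a list"
      by (rule eq_matI) (auto simp: adjacency_mat_def all_ones_def f_def)
    have orth': "(\<Sum>u\<in>?V. W u x * W u y) = of_bool (x = y)" if "x \<in> ?V" "y \<in> ?V" for x y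
    proof (cases "y \<in> range p")
      case True
      then obtain b where b: "y = p b" by auto
      show ?thesis
      proof (cases "x \<in> range p")
        case True
        then obtain a where a: "x = p a" by auto
        show ?thesis using orth inj by (simp add: a b W_inner W_Q inj_eq)
      next
        case False
        then show ?thesis using that W_outer[of x "\<lambda>u. W u (p b)"]
          by (auto simp: b W_outer_inner mult.commute)
      qed
    next
      case False
      then show ?thesis using that W_outer[of y "\<lambda>u. W u x"]
        by (auto simp: W_def)
    qed
    have conj: "(\<Sum>u\<in>?V. W u x * (\<Sum>v\<in>?V. f \<Gamma> u v * W v y)) = f \<Gamma>' x y"
      if "x \<in> ?V" "y \<in> ?V" for x y
    proof -
      \<comment> \<open>Column sums equal to 1 let the constant \<open>r\<close> pass through
        multiplication by \<open>Q\<close> unchanged.\<close>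
      have [simp]: "(\<Sum>c\<in>UNIV. r * Q c b) = r" for b
        by (simp add: ones flip: sum_distrib_left)
      have mix: "(\<Sum>c\<in>UNIV. f \<Gamma> v (p c) * Q c b) = f \<Gamma>' v (p b)"
        if "v \<in> pverts \<Gamma> - range p" for v b
        using mixed[OF that] by (simp add: f_def distrib_right sum.distrib)
      have swap: "f \<Gamma> u v = f \<Gamma> v u" "f \<Gamma>' u v = f \<Gamma>' v u" for u v
        using sym sym' by (auto simp: f_def dest: symD)
      have inn: "(\<Sum>c\<in>UNIV. (\<Sum>d\<in>UNIV. f \<Gamma> (p c) (p d) * Q d b) * Q c a) = f \<Gamma>' (p a) (p b)" for a b
        using inner[of a b]
        by (simp add: f_def distrib_right distrib_left sum.distrib mult.commute[of "Q _ a"])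
      show ?thesis
      proof (cases "y \<in> range p")
        case True
        then obtain b where b: "y = p b" by auto
        show ?thesis
        proof (cases "x \<in> range p")
          case True
          then obtain a where a: "x = p a" by auto
          show ?thesis unfolding a b mult.commute[of "W _ (p a)"] W_inner by (rule inn)
        next
          case False
          then show ?thesis using that unfolding b mult.commute[of "W _ x"] W_inner
            by (simp add: W_outer mix)
        qed
      next
        case y: False
        show ?thesis
        proof (cases "x \<in> range p")
          case True
          then obtain a where a: "x = p a" by auto
          \<comment> \<open>\<open>W_inner\<close> and \<open>W_outer\<close> sum against a column
            of \<open>W\<close> on the right. Evaluating the inner sum first and using symmetry of
            \<open>f\<close> brings this block into the form of \<open>mix\<close>.\<close>
          have "(\<Sum>u\<in>?V. W u x * (\<Sum>v\<in>?V. f \<Gamma> u v * W v y)) = (\<Sum>u\<in>?V. f \<Gamma> y u * W u (p a))"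
            using y that by (simp add: W_outer a swap(1)[of _ y] mult.commute[of "W _ (p a)"])
          also have "\<dots> = f \<Gamma>' x y" using y that by (simp add: W_inner mix a swap)
          finally show ?thesis .
        next
          case False
          then show ?thesis using that y unfolding mult.commute[of "W _ x"]
            by (simp add: W_outer f_def outer)
        qed
      qed
    qed
    show ?thesis unfolding mat
      by (rule spectrum_mset_cong[OF mat_carrier mat_carrier
            char_poly_eq_if_orthogonal_conj[OF xs ys orth' conj]])
  qed
  then show ?thesis by (simp add: R_cospectral_def verts)
qed

section \<open>The action of \<open>R\<^sub>c\<^sub>u\<^sub>b\<^sub>e\<close>\<close>

text \<open>The columns of \<open>2 R\<^sub>c\<^sub>u\<^sub>b\<^sub>e\<close>; integers keep the finite checks below executable.\<close>

definition R_cols :: "int list list" where "R_cols = [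
  [-1,0,1,0,1,0,1,0],
  [0,-1,0,1,0,1,0,1],
  [1,0,0,-1,0,1,1,0],
  [0,1,-1,0,1,0,0,1],
  [1,0,1,0,0,-1,0,1],
  [0,1,0,1,-1,0,1,0],
  [1,0,0,1,1,0,0,-1],
  [0,1,1,0,0,1,-1,0]]"

definition dot :: "int list \<Rightarrow> int list \<Rightarrow> int" where
  "dot r c = sum_list (map2 (*) r c)"

definition rows_times_cols :: "int list list \<Rightarrow> int list list \<Rightarrow> int list list" where
  "rows_times_cols rs cs = map (\<lambda>r. map (dot r) cs) rs"

definition edge_cols :: "nat list \<Rightarrow> int list list" where
  "edge_cols es = map (\<lambda>j. map (\<lambda>i.
     if 10 * (i + 1) + (j + 1) \<in> set es \<or> 10 * (j + 1) + (i + 1) \<in> set es then 1 else 0) [0..<8]) [0..<8]"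

text \<open>If \<open>cs\<close> lists the columns of \<open>B\<close>, these are the rows of \<open>4 R\<^sub>c\<^sub>u\<^sub>b\<^sub>e\<^sup>T B R\<^sub>c\<^sub>u\<^sub>b\<^sub>e\<close>.\<close>

definition conj_cols :: "int list list \<Rightarrow> int list list" where
  "conj_cols cs = rows_times_cols (rows_times_cols R_cols cs) R_cols"

text \<open>Rows on the left are compared with columns on the right, which is harmless for symmetric
  matrices. The 4 clears the two denominators 2.\<close>

definition fixed_cols :: "int list list \<Rightarrow> bool" where
  "fixed_cols cs \<longleftrightarrow> conj_cols cs = map (map ((*) 4)) cs"

text \<open>On the scale used here, 4 stands for the entry 1. Symmetry comes separately, from that
  of the original matrix.\<close>

definition graph_rows :: "int list list \<Rightarrow> bool" where
  "graph_rows rs \<longleftrightarrow> (\<forall>r\<in>set rs. \<forall>x\<in>set r. x = 0 \<or> x = 4) \<and> (\<forall>i\<in>set [0..<8]. rs ! i ! i = 0)"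

lemma fixed_cols_B: "\<forall>es\<in>set (take 5 B_edges). fixed_cols (edge_cols es)"
  unfolding B_edges_def by (simp, intro conjI; code_simp)

lemma graph_rows_B: "\<forall>es\<in>set (drop 5 B_edges). graph_rows (conj_cols (edge_cols es))"
  unfolding B_edges_def by (simp, intro conjI; code_simp)

lemma R_cols_orthogonal: "rows_times_cols R_cols R_cols =
  map (\<lambda>i. map (\<lambda>j. if i = j then 4 else 0) [0..<8]) [0..<8]"
  by code_simp

lemma R_rows_eq: "R_rows = map (\<lambda>i. map (\<lambda>j. real_of_int (R_cols ! j ! i)) [0..<8]) [0..<8]"
  by (simp add: R_rows_def R_cols_def upt_rec numeral_eq_Suc)

section \<open>Passing between points and matrix positions, and between integer and real
  entries\<close>

definition point_index :: "point \<Rightarrow> nat" where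
  "point_index q = length (takeWhile (\<lambda>x. x \<noteq> q) points)"

lemma point_index_less: "point_index q < 8"
proof -
  have "\<forall>q\<in>set points. point_index q < 8" by code_simp
  then show ?thesis using mem_points by blast
qed

lemma points_point_index [simp]: "points ! point_index q = q"
proof -
  have "\<forall>q\<in>set points. points ! point_index q = q" by code_simp
  then show ?thesis using mem_points by blast
qed

lemma point_index_eq_iff: "point_index q = point_index q' \<longleftrightarrow> q = q'"
  by (metis points_point_index)

lemma length_points [simp]: "length points = 8"
  by (simp add: points_def)

lemma distinct_points: "distinct points"
  by code_simp

lemma point_index_points [simp]: "i < 8 \<Longrightarrow> point_index (points ! i) = i"
  using distinct_points nth_eq_iff_index_eq[of points "point_index (points ! i)" i]
  by (simp add: point_index_less)

lemma sum_points: "sum f (UNIV :: point set) = (\<Sum>i<8. f (points ! i))"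
  using sum_nth_permutation[of points UNIV f] distinct_points
  by (simp add: permutations_of_set_def flip: UNIV_point)

lemma R_cube_carrier: "R_cube \<in> carrier_mat 8 8"
  by (simp add: R_cube_entries)

lemma R_cube_nth:
  assumes "i < 8" "j < 8"
  shows "R_cube $$ (i, j) = real_of_int (R_cols ! j ! i) / 2"
  using assms by (simp add: R_cube_entries R_rows_eq)

lemma length_R_cols: "length R_cols = 8" "i < 8 \<Longrightarrow> length (R_cols ! i) = 8"
proof -
  have "length R_cols = 8" "\<forall>r\<in>set R_cols. length r = 8" by code_simp+
  then show "length R_cols = 8" "i < 8 \<Longrightarrow> length (R_cols ! i) = 8" by auto
qed

lemma dot_conv_sum:
  assumes "length r = n" "length c = n"
  shows "dot r c = (\<Sum>k<n. r ! k * c ! k)"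
  using assms by (simp add: dot_def sum_list_sum_nth lessThan_atLeast0)

text \<open>After clearing denominators this is the evaluated identity
  \<open>R_cols_orthogonal\<close>.\<close>

lemma R_cube_orthogonal:
  assumes "i < 8" "j < 8"
  shows "(\<Sum>k<8. R_cube $$ (k, i) * R_cube $$ (k, j)) = of_bool (i = j)"
proof -
  have "rows_times_cols R_cols R_cols ! i ! j = (\<Sum>k<8. R_cols ! i ! k * R_cols ! j ! k)"
    using assms by (simp add: rows_times_cols_def length_R_cols dot_conv_sum[of _ 8])
  then have int: "(\<Sum>k<8. R_cols ! i ! k * R_cols ! j ! k) = (if i = j then 4 else 0)"
    using assms by (simp add: R_cols_orthogonal)
  have "(\<Sum>k<8. R_cube $$ (k, i) * R_cube $$ (k, j)) =
      real_of_int (\<Sum>k<8. R_cols ! i ! k * R_cols ! j ! k) / 4"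
    using assms by (simp add: R_cube_nth sum_divide_distrib)
  then show ?thesis unfolding int by (cases "i = j") simp_all
qed

lemma B_mat_nth: "i < 8 \<Longrightarrow> j < 8 \<Longrightarrow>
    B_mat k $$ (i, j) = real_of_int (edge_cols (B_edges ! (k - 1)) ! j ! i)"
  by (simp add: B_mat_def edge_cols_def)

text \<open>Each of the two factors \<open>R_cube\<close> contributes a denominator 2; the rest is
  the integer computation in \<open>conj_cols\<close>.\<close>

lemma conj_B_mat_nth:
  assumes "i < 8" "j < 8"
  shows "(transpose_mat R_cube * B_mat k * R_cube) $$ (i, j) =
    real_of_int (conj_cols (edge_cols (B_edges ! (k - 1))) ! i ! j) / 4"
proof -
  define cs where "cs = edge_cols (B_edges ! (k - 1))"
  have len: "length cs = 8" "\<And>l. l < 8 \<Longrightarrow> length (cs ! l) = 8"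
    by (simp_all add: edge_cols_def cs_def)
  have "conj_cols cs ! i ! j = (\<Sum>l<8. (\<Sum>k<8. R_cols ! i ! k * cs ! l ! k) * R_cols ! j ! l)"
    using assms by (simp add: conj_cols_def rows_times_cols_def length_R_cols len dot_conv_sum[of _ 8])
  moreover have "(transpose_mat R_cube * B_mat k * R_cube) $$ (i, j) =
      (\<Sum>l<8. (\<Sum>k'<8. R_cube $$ (k', i) * B_mat k $$ (k', l)) * R_cube $$ (l, j))"
    using assms R_cube_carrier by (simp add: B_mat_def scalar_prod_def lessThan_atLeast0)
  moreover have "B_mat k $$ (k', l) = real_of_int (cs ! l ! k')" if "k' < 8" "l < 8" for k' l
    using that by (simp add: B_mat_nth cs_def)
  ultimately show ?thesis unfolding cs_def[symmetric]
    using assms by (simp add: R_cube_nth sum_divide_distrib sum_distrib_right)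
qed

lemma B_edges_nth_mem: "k \<in> {1..5} \<Longrightarrow> B_edges ! (k - 1) \<in> set (take 5 B_edges)"
  "k \<in> {6..40} \<Longrightarrow> B_edges ! (k - 1) \<in> set (drop 5 B_edges)"
proof -
  have len: "length B_edges = 40" by (simp add: B_edges_def)
  show "k \<in> {1..5} \<Longrightarrow> B_edges ! (k - 1) \<in> set (take 5 B_edges)"
    using len by (auto simp: in_set_conv_nth intro!: exI[of _ "k - 1"])
  \<comment> \<open>Dropping five entries from a list that starts at 0 puts the k-th graph at
    position \<open>k - 6\<close>.\<close>
  show "k \<in> {6..40} \<Longrightarrow> B_edges ! (k - 1) \<in> set (drop 5 B_edges)"
    using len by (auto simp: in_set_conv_nth intro!: exI[of _ "k - 6"])
qed

lemma conj_B_mat_fixed: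
  assumes "k \<in> {1..5}"
  shows "transpose_mat R_cube * B_mat k * R_cube = B_mat k"
proof (rule eq_matI)
  fix i j assume "i < dim_row (B_mat k)" "j < dim_col (B_mat k)"
  then have ij: "i < 8" "j < 8" by (auto simp: B_mat_def)
  have "fixed_cols (edge_cols (B_edges ! (k - 1)))"
    using fixed_cols_B B_edges_nth_mem(1)[OF assms] by blast
  then have "conj_cols (edge_cols (B_edges ! (k - 1))) ! i ! j = 4 * edge_cols (B_edges ! (k - 1)) ! i ! j"
    using ij by (simp add: fixed_cols_def edge_cols_def)
  \<comment> \<open>Symmetry reconciles the rows of \<open>conj_cols\<close> with the columns of
    \<open>edge_cols\<close>.\<close>
  also have "edge_cols (B_edges ! (k - 1)) ! i ! j = edge_cols (B_edges ! (k - 1)) ! j ! i"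
    using ij by (auto simp: edge_cols_def)
  finally show "(transpose_mat R_cube * B_mat k * R_cube) $$ (i, j) = B_mat k $$ (i, j)"
    using ij by (simp add: conj_B_mat_nth B_mat_nth)
qed (use R_cube_carrier in \<open>auto simp: B_mat_def\<close>)

lemma conj_B_mat_graph:
  assumes k: "k \<in> {6..40}" and "i < 8" "j < 8"
  defines "N \<equiv> transpose_mat R_cube * B_mat k * R_cube"
  shows "N $$ (i, j) = 0 \<or> N $$ (i, j) = 1" "N $$ (i, i) = 0"
proof -
  let ?rs = "conj_cols (edge_cols (B_edges ! (k - 1)))"
  have *: "graph_rows ?rs"
    using graph_rows_B B_edges_nth_mem(2)[OF k] by blast
  have len: "length ?rs = 8" "length (?rs ! i) = 8"
    using assms by (simp_all add: conj_cols_def rows_times_cols_def length_R_cols)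
  then have "?rs ! i ! j \<in> set (?rs ! i)" "?rs ! i \<in> set ?rs" "?rs ! i ! i = 0"
    using assms * by (auto simp: graph_rows_def)
  then have "?rs ! i ! j = 0 \<or> ?rs ! i ! j = 4" "?rs ! i ! i = 0"
    using * unfolding graph_rows_def by blast+
  then show "N $$ (i, j) = 0 \<or> N $$ (i, j) = 1" "N $$ (i, i) = 0"
    unfolding N_def using assms by (auto simp: conj_B_mat_nth)
qed

section \<open>The switched graph, block by block\<close>

lemma parcs_switch:
  assumes graph: "pair_graph \<Gamma>" and inj: "inj p" and C: "range p \<subseteq> pverts \<Gamma>"
  defines "N \<equiv> switched_B (adjacency_mat \<Gamma> (map p points))"
  shows "(p a, p b) \<in> parcs (switch \<Gamma> p \<pi>) \<longleftrightarrow> N $$ (point_index a, point_index b) = 1"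
    and "v \<in> pverts \<Gamma> - range p \<Longrightarrow>
      (v, p b) \<in> parcs (switch \<Gamma> p \<pi>) \<longleftrightarrow> b \<in> switched_nbhd \<pi> (nbhd \<Gamma> p v)"
    and "v \<in> pverts \<Gamma> - range p \<Longrightarrow>
      (p b, v) \<in> parcs (switch \<Gamma> p \<pi>) \<longleftrightarrow> b \<in> switched_nbhd \<pi> (nbhd \<Gamma> p v)"
    and "u \<in> pverts \<Gamma> - range p \<Longrightarrow> v \<in> pverts \<Gamma> - range p \<Longrightarrow>
      (u, v) \<in> parcs (switch \<Gamma> p \<pi>) \<longleftrightarrow> (u, v) \<in> parcs \<Gamma>"
    and "parcs (switch \<Gamma> p \<pi>) \<subseteq> pverts \<Gamma> \<times> pverts \<Gamma>"
proof -
  interpret pair_graph \<Gamma> by (rule graph)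
  \<comment> \<open>Positions below 8 correspond to points, so the arcs inside C can be parametrised
    by points.\<close>
  have idx: "(\<exists>i j. x = p (points ! i) \<and> y = p (points ! j) \<and> i < 8 \<and> j < 8 \<and> N $$ (i, j) = 1) \<longleftrightarrow>
      (\<exists>a b. x = p a \<and> y = p b \<and> N $$ (point_index a, point_index b) = 1)" for x y
    by (metis point_index_less point_index_points points_point_index)
  have arcs: "(x, y) \<in> parcs (switch \<Gamma> p \<pi>) \<longleftrightarrow>
      (x, y) \<in> parcs \<Gamma> \<and> x \<notin> range p \<and> y \<notin> range p \<or>
      (\<exists>q. y = p q \<and> x \<in> pverts \<Gamma> - range p \<and> q \<in> switched_nbhd \<pi> (nbhd \<Gamma> p x)) \<or>
      (\<exists>q. x = p q \<and> y \<in> pverts \<Gamma> - range p \<and> q \<in> switched_nbhd \<pi> (nbhd \<Gamma> p y)) \<or>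
      (\<exists>a b. x = p a \<and> y = p b \<and> N $$ (point_index a, point_index b) = 1)" for x y
    unfolding idx[symmetric] by (simp add: switch_def N_def del: split_paired_Ex)
  show "(p a, p b) \<in> parcs (switch \<Gamma> p \<pi>) \<longleftrightarrow> N $$ (point_index a, point_index b) = 1"
    using inj unfolding arcs by (simp add: inj_eq del: split_paired_Ex)
  \<comment> \<open>This separates the clauses of \<open>arcs\<close>: an outside vertex is never a
    labelled one.\<close>
  have "p q \<noteq> v" if "v \<in> pverts \<Gamma> - range p" for q v
    using that by auto
  note [simp] = this this[symmetric]
  show "v \<in> pverts \<Gamma> - range p \<Longrightarrow>
      (v, p b) \<in> parcs (switch \<Gamma> p \<pi>) \<longleftrightarrow> b \<in> switched_nbhd \<pi> (nbhd \<Gamma> p v)"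
    using inj unfolding arcs by (simp add: inj_eq del: split_paired_Ex)
  show "v \<in> pverts \<Gamma> - range p \<Longrightarrow>
      (p b, v) \<in> parcs (switch \<Gamma> p \<pi>) \<longleftrightarrow> b \<in> switched_nbhd \<pi> (nbhd \<Gamma> p v)"
    using inj unfolding arcs by (simp add: inj_eq del: split_paired_Ex)
  show "u \<in> pverts \<Gamma> - range p \<Longrightarrow> v \<in> pverts \<Gamma> - range p \<Longrightarrow>
      (u, v) \<in> parcs (switch \<Gamma> p \<pi>) \<longleftrightarrow> (u, v) \<in> parcs \<Gamma>"
    unfolding arcs by auto
  show "parcs (switch \<Gamma> p \<pi>) \<subseteq> pverts \<Gamma> \<times> pverts \<Gamma>"
  proof (rule subrelI)
    fix x y assume "(x, y) \<in> parcs (switch \<Gamma> p \<pi>)"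
    moreover have "p q \<in> pverts \<Gamma>" for q using C by auto
    ultimately show "(x, y) \<in> pverts \<Gamma> \<times> pverts \<Gamma>"
      using arc_fst_in_verts[of "(x, y)"] arc_snd_in_verts[of "(x, y)"]
      unfolding arcs by (elim disjE exE) simp_all
  qed
qed

lemma sym_parcs:
  assumes "pair_graph \<Gamma>"
  shows "sym (parcs \<Gamma>)"
proof -
  interpret pair_graph \<Gamma> by fact
  show ?thesis using pair_sym_arcs by (simp add: symmetric_def)
qed

text \<open>Arcs between C and its complement are inserted in both directions, and those outside are
  inherited. Hence only the new matrix on C can break symmetry or create loops.\<close>

lemma pair_graph_switch:
  assumes graph: "pair_graph \<Gamma>" and inj: "inj p" and C: "range p \<subseteq> pverts \<Gamma>"
    and N: "N = switched_B (adjacency_mat \<Gamma> (map p points))"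
    and N_sym: "\<And>i j. i < 8 \<Longrightarrow> j < 8 \<Longrightarrow> N $$ (i, j) = N $$ (j, i)"
    and N_diag: "\<And>i. i < 8 \<Longrightarrow> N $$ (i, i) \<noteq> 1"
  shows "pair_graph (switch \<Gamma> p \<pi>)"
proof -
  interpret pair_graph \<Gamma> by (rule graph)
  note arcs = parcs_switch[OF graph inj C, folded N, where \<pi> = \<pi>]
  have V: "pverts (switch \<Gamma> p \<pi>) = pverts \<Gamma>" by (simp add: switch_def)
  have sym: "(v, u) \<in> parcs (switch \<Gamma> p \<pi>)" if "(u, v) \<in> parcs (switch \<Gamma> p \<pi>)" for u v
  proof -
    have uv: "u \<in> pverts \<Gamma>" "v \<in> pverts \<Gamma>" using arcs(5) that by auto
    show ?thesis
    proof (cases "u \<in> range p"; cases "v \<in> range p")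
      assume "u \<in> range p" "v \<in> range p"
      then obtain a b where ab: "u = p a" "v = p b" by auto
      show ?thesis using that N_sym[OF point_index_less point_index_less]
        unfolding ab arcs(1) by metis
    next
      assume "u \<in> range p" "v \<notin> range p"
      then show ?thesis using that arcs(2,3) uv by auto
    next
      assume "u \<notin> range p" "v \<in> range p"
      then show ?thesis using that arcs(2,3) uv by auto
    next
      assume "u \<notin> range p" "v \<notin> range p"
      then show ?thesis using that uv pair_sym_arcs arcs(4) by (auto dest: symD simp: symmetric_def)
    qed
  qed
  have loop: "(u, u) \<notin> parcs (switch \<Gamma> p \<pi>)" for u
  proof (cases "u \<in> range p")
    case True
    then obtain a where "u = p a" by auto
    then show ?thesis using arcs(1) N_diag point_index_less by auto
  next
    case False
    then show ?thesis
      using arcs(4)[of u u] arcs(5) pair_no_loops[of "(u, u)"] by auto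
  qed
  show ?thesis
  proof
    show "finite (parcs (switch \<Gamma> p \<pi>))"
      using arcs(5) pair_finite_verts by (meson finite_SigmaI finite_subset)
    show "symmetric (with_proj (switch \<Gamma> p \<pi>))"
      unfolding symmetric_def by (rule symI) (use sym in simp)
  qed (use V pair_finite_verts loop arcs(5) in \<open>auto simp: subset_iff\<close>)
qed

text \<open>\<open>switch\<close> records only the positions of the entries 1, which determine the
  matrix once all other entries are known to be 0.\<close>

lemma adjacency_mat_switch:
  assumes graph: "pair_graph \<Gamma>" and inj: "inj p" and C: "range p \<subseteq> pverts \<Gamma>"
    and N: "N = switched_B (adjacency_mat \<Gamma> (map p points))"
    and N_carrier: "N \<in> carrier_mat 8 8"
    and N_01: "\<And>i j. i < 8 \<Longrightarrow> j < 8 \<Longrightarrow> N $$ (i, j) = 0 \<or> N $$ (i, j) = 1"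
  shows "adjacency_mat (switch \<Gamma> p \<pi>) (map p points) = N"
proof (rule eq_matI)
  fix i j assume "i < dim_row N" "j < dim_col N"
  then have "i < 8" "j < 8" using N_carrier by auto
  then show "adjacency_mat (switch \<Gamma> p \<pi>) (map p points) $$ (i, j) = N $$ (i, j)"
    using N_01[of i j] by (auto simp: adjacency_mat_def parcs_switch[OF graph inj C] N)
qed (use N_carrier in \<open>auto simp: adjacency_mat_def\<close>)

section \<open>The action on neighbourhoods\<close>

definition indicators :: "point set \<Rightarrow> int list" where
  "indicators S = map (\<lambda>q. if q \<in> S then 1 else 0) points"

text \<open>The integer form, scaled by 2, of the statement that the transpose of
  \<open>R_cube\<close> sends \<open>char_vec S\<close> to \<open>char_vec T\<close>.\<close>

definition R_maps :: "point set \<Rightarrow> point set \<Rightarrow> bool" where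
  "R_maps S T \<longleftrightarrow> map (\<lambda>r. dot r (indicators S)) R_cols = map ((*) 2) (indicators T)"

lemma R_mapsD:
  assumes "R_maps S T" "j < 8"
  shows "(\<Sum>i<8. R_cols ! j ! i * indicators S ! i) = 2 * indicators T ! j"
proof -
  have len: "length (indicators S) = 8" for S by (simp add: indicators_def)
  from assms(1) have "map (\<lambda>r. dot r (indicators S)) R_cols ! j = map ((*) 2) (indicators T) ! j"
    by (simp only: R_maps_def)
  then show ?thesis
    using assms(2) by (simp add: length_R_cols len dot_conv_sum[of _ 8])
qed

definition R_fixes :: "point set \<Rightarrow> bool" where "R_fixes S \<longleftrightarrow> R_maps S S"

text \<open>The complement is taken in \<open>set points\<close>, an explicit finite set suited to
  evaluation.\<close>

definition R_complements :: "point set \<Rightarrow> bool" where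
  "R_complements S \<longleftrightarrow> R_maps S (set points - S)"

lemma R_complements_edge_planes: "\<forall>S\<in>edge_planes. R_complements S"
  unfolding edge_planes_code by code_simp

lemma R_fixes_planes: "\<forall>S\<in>set [set points, {}, {(0,0,0), (0,1,1), (1,0,1), (1,1,0)},
    {(1,1,1), (1,0,0), (0,1,0), (0,0,1)}]. R_fixes S"
  by code_simp

text \<open>On faces this is the assumption on \<pi>. The remaining sets do not involve \<pi> and
  are settled by the finite checks above.\<close>

lemma R_cube_switches_planes:
  assumes \<pi>: "realised_by_R_cube \<pi>"
    and S: "S = UNIV \<or> S = {} \<or> S \<in> affine_planes"
  shows "transpose_mat R_cube *\<^sub>v char_vec S = char_vec (switched_nbhd \<pi> S)"
proof (cases "S \<in> faces")
  case True
  then show ?thesis using \<pi> by (simp add: realised_by_R_cube_def switched_nbhd_def)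
next
  case False
  let ?T = "if S \<in> edge_planes then UNIV - S else S"
  have "R_maps S ?T"
  proof (cases "S \<in> edge_planes")
    case True
    then show ?thesis using R_complements_edge_planes by (simp add: R_complements_def UNIV_point)
  next
    case e: False
    \<comment> \<open>Besides faces and edge planes there remain the full set, the empty set and the
      two planes of non-adjacent points.\<close>
    then have "S \<in> set [set points, {}] \<union> nonadjacent_planes"
      using S False affine_planes_eq by (auto simp: UNIV_point)
    then show ?thesis using e R_fixes_planes unfolding nonadjacent_planes_code
      by (auto simp: R_fixes_def)
  qed
  note ints = R_mapsD[OF this]
  have "transpose_mat R_cube *\<^sub>v char_vec S = char_vec ?T"
  proof (rule eq_vecI)
    fix j assume "j < dim_vec (char_vec ?T)"
    then have j: "j < 8" by (simp add: char_vec_def)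
    have "(transpose_mat R_cube *\<^sub>v char_vec S) $ j =
        real_of_int (\<Sum>i<8. R_cols ! j ! i * indicators S ! i) / 2"
      using j R_cube_carrier
      by (auto simp: char_vec_def indicators_def scalar_prod_def lessThan_atLeast0 R_cube_nth
          sum_divide_distrib intro!: sum.cong)
    then show "(transpose_mat R_cube *\<^sub>v char_vec S) $ j = char_vec ?T $ j"
      unfolding ints[OF j] using j by (simp add: char_vec_def indicators_def)
  qed (use R_cube_carrier in \<open>auto simp: char_vec_def\<close>)
  then show ?thesis using False by (simp add: switched_nbhd_def)
qed

lemma R_cospectral_switch:
  assumes graph: "pair_graph \<Gamma>" and graph': "pair_graph (switch \<Gamma> p \<pi>)"
    and inj: "inj p" and C: "range p \<subseteq> pverts \<Gamma>"
    and ii: "\<And>v. v \<in> pverts \<Gamma> - range p \<Longrightarrow>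
               nbhd \<Gamma> p v = UNIV \<or> nbhd \<Gamma> p v = {} \<or> nbhd \<Gamma> p v \<in> affine_planes"
    and \<pi>: "realised_by_R_cube \<pi>"
    and inside: "adjacency_mat (switch \<Gamma> p \<pi>) (map p points) =
      transpose_mat R_cube * adjacency_mat \<Gamma> (map p points) * R_cube"
  shows "R_cospectral \<Gamma> (switch \<Gamma> p \<pi>)"
proof -
  define Q where "Q = (\<lambda>c d. R_cube $$ (point_index c, point_index d))"
  have char_vec: "(\<Sum>c\<in>UNIV. of_bool (c \<in> S) * Q c b) = of_bool (b \<in> switched_nbhd \<pi> S)"
    if "S = UNIV \<or> S = {} \<or> S \<in> affine_planes" for S b
  proof -
    have "(\<Sum>c\<in>UNIV. of_bool (c \<in> S) * Q c b) = (transpose_mat R_cube *\<^sub>v char_vec S) $ point_index b"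
      using R_cube_carrier point_index_less[of b]
      by (simp add: sum_points char_vec_def scalar_prod_def lessThan_atLeast0 Q_def mult.commute)
    also have "\<dots> = of_bool (b \<in> switched_nbhd \<pi> S)"
      unfolding R_cube_switches_planes[OF \<pi> that]
      using point_index_less[of b] by (simp add: char_vec_def)
    finally show ?thesis .
  qed
  note arcs = parcs_switch[OF graph inj C, where \<pi> = \<pi>]
  show ?thesis
  proof (rule R_cospectral_switching[OF inj C _ sym_parcs[OF graph] sym_parcs[OF graph'], where Q = Q])
    show "(\<Sum>c\<in>UNIV. Q c a * Q c b) = of_bool (a = b)" for a b
      using R_cube_orthogonal[OF point_index_less point_index_less, of a b]
      by (simp add: sum_points Q_def point_index_eq_iff)
    \<comment> \<open>The column sums of \<open>Q\<close> are the image of the all-ones vector,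
      which is the case \<open>S = UNIV\<close> of \<open>char_vec\<close>.\<close>
    have "switched_nbhd \<pi> UNIV = UNIV"
    proof -
      have "set points \<notin> faces" "set points \<notin> edge_planes"
        unfolding faces_code edge_planes_code by code_simp+
      then show ?thesis by (simp add: switched_nbhd_def UNIV_point)
    qed
    then show "(\<Sum>c\<in>UNIV. Q c b) = 1" for b
      using char_vec[of UNIV b] by simp
    show "(\<Sum>c\<in>UNIV. of_bool ((v, p c) \<in> parcs \<Gamma>) * Q c b) = of_bool ((v, p b) \<in> parcs (switch \<Gamma> p \<pi>))"
      if "v \<in> pverts \<Gamma> - range p" for v b
      using char_vec[OF ii[OF that], of b] arcs(2)[OF that, of b] by (simp add: nbhd_def)
    show "(\<Sum>c\<in>UNIV. Q c a * (\<Sum>d\<in>UNIV. of_bool ((p c, p d) \<in> parcs \<Gamma>) * Q d b))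
        = of_bool ((p a, p b) \<in> parcs (switch \<Gamma> p \<pi>))" for a b
    proof -
      let ?M = "adjacency_mat \<Gamma> (map p points)"
      have "of_bool ((p a, p b) \<in> parcs (switch \<Gamma> p \<pi>)) =
          adjacency_mat (switch \<Gamma> p \<pi>) (map p points) $$ (point_index a, point_index b)"
        by (simp add: adjacency_mat_def point_index_less)
      also have "\<dots> = (transpose_mat R_cube * (?M * R_cube)) $$ (point_index a, point_index b)"
        unfolding inside using R_cube_carrier
        by (subst assoc_mult_mat[of _ 8 8 _ 8 _ 8]) (auto simp: adjacency_mat_def)
      also have "\<dots> = (\<Sum>c\<in>UNIV. Q c a * (\<Sum>d\<in>UNIV. of_bool ((p c, p d) \<in> parcs \<Gamma>) * Q d b))"
        using R_cube_carrier point_index_less[of a] point_index_less[of b]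
        by (simp add: adjacency_mat_def sum_points scalar_prod_def lessThan_atLeast0 Q_def)
      finally show ?thesis by simp
    qed
  qed (use arcs(4) in \<open>auto simp: switch_def\<close>)
qed

lemma transpose_adjacency_mat:
  assumes "pair_graph \<Gamma>"
  shows "transpose_mat (adjacency_mat \<Gamma> xs) = adjacency_mat \<Gamma> xs"
  using sym_parcs[OF assms] by (intro eq_matI) (auto simp: adjacency_mat_def dest: symD)

text \<open>The common core of both cases: assumption \<open>N\<close> holds for B_6 to B_40 by
  definition of \<open>switched_B\<close>, and for B_1 to B_5 because conjugation fixes these
  matrices.\<close>

lemma switch_realised:
  assumes graph: "pair_graph \<Gamma>" and inj: "inj p" and C: "range p \<subseteq> pverts \<Gamma>"
    and ii: "\<And>v. v \<in> pverts \<Gamma> - range p \<Longrightarrow>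
               nbhd \<Gamma> p v = UNIV \<or> nbhd \<Gamma> p v = {} \<or> nbhd \<Gamma> p v \<in> affine_planes"
    and \<pi>: "realised_by_R_cube \<pi>"
    and M: "M = adjacency_mat \<Gamma> (map p points)"
    and N: "switched_B M = transpose_mat R_cube * M * R_cube"
    and N_01: "\<And>i j. i < 8 \<Longrightarrow> j < 8 \<Longrightarrow> switched_B M $$ (i, j) = 0 \<or> switched_B M $$ (i, j) = 1"
    and N_diag: "\<And>i. i < 8 \<Longrightarrow> switched_B M $$ (i, i) = 0"
  shows "pair_graph (switch \<Gamma> p \<pi>) \<and>
    adjacency_mat (switch \<Gamma> p \<pi>) (map p points) = switched_B M \<and>
    R_cospectral \<Gamma> (switch \<Gamma> p \<pi>)"
proof -
  note [simp] = R_cube_carrier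
  have M_carrier: "M \<in> carrier_mat 8 8" by (simp add: M adjacency_mat_def)
  then have N_carrier: "switched_B M \<in> carrier_mat 8 8"
    unfolding N by (intro mult_carrier_mat[of _ 8 8]) auto
  have "transpose_mat M = M"
    unfolding M by (rule transpose_adjacency_mat[OF graph])
  \<comment> \<open>Conjugation by R and its transpose keeps a symmetric matrix symmetric.\<close>
  then have "transpose_mat (switched_B M) = transpose_mat R_cube * (M * R_cube)"
    unfolding N using M_carrier
      transpose_mult[of "transpose_mat R_cube * M" 8 8 R_cube 8]
      transpose_mult[of "transpose_mat R_cube" 8 8 M 8] by simp
  also have "\<dots> = switched_B M"
    unfolding N using M_carrier assoc_mult_mat[of "transpose_mat R_cube" 8 8 M 8 R_cube 8] by simp
  finally have sym: "switched_B M $$ (i, j) = switched_B M $$ (j, i)" if "i < 8" "j < 8" for i j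
    using that N_carrier by (metis carrier_matD index_transpose_mat(1))
  have graph': "pair_graph (switch \<Gamma> p \<pi>)"
    by (rule pair_graph_switch[OF graph inj C refl]) (use sym N_diag in \<open>auto simp flip: M\<close>)
  moreover have adj: "adjacency_mat (switch \<Gamma> p \<pi>) (map p points) = switched_B M"
    by (rule adjacency_mat_switch[OF graph inj C]) (use M N_carrier N_01 in auto)
  moreover have "R_cospectral \<Gamma> (switch \<Gamma> p \<pi>)"
    by (rule R_cospectral_switch[OF graph graph' inj C ii \<pi>]) (use adj M N in auto)
  ultimately show ?thesis by blast
qed

section \<open>Automorphisms of order six\<close>

definition rot_antipode :: "point \<Rightarrow> point" where
  "rot_antipode = (\<lambda>(x, y, z). (y + 1, z + 1, x + 1))"

lemma realised_rot_antipode: "realised_by_R_cube rot_antipode"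
  unfolding rot_antipode_def by (rule realised_example)

text \<open>
  The translations by the vectors \<open>(a, b, a + b)\<close> of even weight, optionally preceded by the exchange
  of the last two coordinates. These eight symmetries are enough to conjugate
  \<open>rot_antipode\<close> to every automorphism of order six, and they are chosen so as to preserve
  \<open>B\<^sub>1, \<dots>, B\<^sub>5\<close>; other symmetries of the cube need not preserve \<open>B\<^sub>4\<close> and \<open>B\<^sub>5\<close>.
\<close>

fun cube_sym :: "bool \<Rightarrow> bit \<Rightarrow> bit \<Rightarrow> point \<Rightarrow> point" where
  "cube_sym s a b (x, y, z) = (if s then (x + a, z + b, y + (a + b)) else (x + a, y + b, z + (a + b)))"

text \<open>Ordered by weight and searched in reverse, since \<open>cube_maps\<close> treats the
  tail first. The origin and its three neighbours are placed first, and these determine the rest, so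
  the search stays small.\<close>

definition cube_points :: "point list" where
  "cube_points = [(0,0,0), (1,0,0), (0,1,0), (0,0,1), (1,1,0), (1,0,1), (0,1,1), (1,1,1)]"

text \<open>All partial cube automorphisms with domain the given points, by backtracking.\<close>

primrec cube_maps :: "point list \<Rightarrow> (point \<times> point) list list" where
  "cube_maps [] = [[]]"
| "cube_maps (q # qs) = concat (map (\<lambda>xs. map (\<lambda>y. (q, y) # xs)
     (filter (\<lambda>y. \<forall>(q', y')\<in>set xs. (y = y') = (q = q') \<and> cube_adj y y' = cube_adj q q') points)) (cube_maps qs))"

definition look :: "(point \<times> point) list \<Rightarrow> point \<Rightarrow> point" where
  "look xs q = the (map_of xs q)"

text \<open>The three premises say that the order divides 6 but neither 2 nor 3. Eight symmetries
  suffice: the only involution commuting with \<open>rot_antipode\<close> is the antipodal map,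
  which is none of them, so they yield eight distinct conjugates.\<close>

lemma order_six_search: "\<forall>xs\<in>set (cube_maps (rev cube_points)).
   (\<forall>q\<in>set cube_points. look xs (look xs (look xs (look xs (look xs (look xs q))))) = q) \<longrightarrow>
   (\<exists>q\<in>set cube_points. look xs (look xs q) \<noteq> q) \<longrightarrow>
   (\<exists>q\<in>set cube_points. look xs (look xs (look xs q)) \<noteq> q) \<longrightarrow>
   (\<exists>s\<in>set [True, False]. \<exists>a\<in>set [0, 1]. \<exists>b\<in>set [0, 1].
     \<forall>q\<in>set cube_points. look xs (cube_sym s a b q) = cube_sym s a b (rot_antipode q))"
  by code_simp

lemma cube_automorphismD:
  assumes "cube_automorphism f"
  shows "bij f" "inj f" "surj f" "cube_adj (f q) (f q') \<longleftrightarrow> cube_adj q q'"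
proof -
  show bij: "bij f" and "cube_adj (f q) (f q') \<longleftrightarrow> cube_adj q q'"
    using assms unfolding cube_automorphism_def by blast+
  show "inj f" "surj f" using bij by (rule bij_is_inj, rule bij_is_surj)
qed

text \<open>An automorphism is injective and preserves adjacency both ways, so its restrictions
  survive every filter of the search.\<close>

lemma cube_maps_complete:
  assumes "cube_automorphism \<pi>"
  shows "map (\<lambda>q. (q, \<pi> q)) qs \<in> set (cube_maps qs)"
proof (induction qs)
  case (Cons q qs)
  let ?xs = "map (\<lambda>q. (q, \<pi> q)) qs"
  let ?ys = "filter (\<lambda>y. \<forall>(q', y')\<in>set ?xs. (y = y') = (q = q') \<and> cube_adj y y' = cube_adj q q') points"
  have "\<pi> q \<in> set ?ys"
    using mem_points[of "\<pi> q"]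
    by (simp add: cube_automorphismD(4)[OF assms] inj_eq[OF cube_automorphismD(2)[OF assms]])
  then have *: "(q, \<pi> q) # ?xs \<in> set (map (\<lambda>y. (q, y) # ?xs) ?ys)"
    unfolding set_map by (rule imageI)
  have "map (\<lambda>y. (q, y) # ?xs) ?ys \<in> set (map (\<lambda>xs. map (\<lambda>y. (q, y) # xs)
      (filter (\<lambda>y. \<forall>(q', y')\<in>set xs. (y = y') = (q = q') \<and> cube_adj y y' = cube_adj q q') points)) (cube_maps qs))"
    unfolding set_map by (rule image_eqI[OF _ Cons]) (simp only: set_map)
  then show ?case
    unfolding cube_maps.simps list.map(2) set_concat by (rule UN_I) (rule *)
qed simp

lemma cube_points_UNIV: "set cube_points = UNIV"
proof -
  have "set points \<subseteq> set cube_points" by code_simp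
  then show ?thesis by (metis UNIV_point top.extremum_uniqueI)
qed

lemma order_six_conj:
  assumes "order_six_automorphism \<pi>"
  shows "\<exists>s a b. \<pi> \<circ> cube_sym s a b = cube_sym s a b \<circ> rot_antipode"
proof -
  have aut: "cube_automorphism \<pi>" and six: "\<pi> ^^ 6 = id"
    and "\<pi> ^^ 2 \<noteq> id" "\<pi> ^^ 3 \<noteq> id"
    using assms by (auto simp: order_six_automorphism_def)
  then have pow: "\<forall>q. \<pi> (\<pi> (\<pi> (\<pi> (\<pi> (\<pi> q))))) = q" "\<exists>q. \<pi> (\<pi> q) \<noteq> q" "\<exists>q. \<pi> (\<pi> (\<pi> q)) \<noteq> q"
    by (simp_all add: numeral_eq_Suc fun_eq_iff del: split_paired_All split_paired_Ex)
  define xs where "xs = map (\<lambda>q. (q, \<pi> q)) (rev cube_points)"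
  \<comment> \<open>The list covers all points, so the lookup never meets a missing value.\<close>
  have "look xs q = \<pi> q" for q
    using cube_points_UNIV by (simp add: look_def xs_def map_of_map_restrict restrict_map_def)
  then have look: "look xs = \<pi>" by auto
  have "xs \<in> set (cube_maps (rev cube_points))"
    unfolding xs_def by (rule cube_maps_complete[OF aut])
  from bspec[OF order_six_search this] pow
  have "\<exists>s\<in>set [True, False]. \<exists>a\<in>set [0, 1]. \<exists>b\<in>set [0, 1].
     \<forall>q. \<pi> (cube_sym s a b q) = cube_sym s a b (rot_antipode q)"
    unfolding look cube_points_UNIV by (simp only: ball_UNIV bex_UNIV simp_thms)
  then show ?thesis unfolding fun_eq_iff comp_apply by metis
qed

text \<open>The exchange swaps the last two entries of the translation vector
  \<open>(a, b, a + b)\<close>, which replaces \<open>b\<close> by \<open>a + b\<close>.\<close>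

lemma cube_sym_inverse: "cube_sym s a (if s then a + b else b) (cube_sym s a b q) = q"
  by (cases q; cases s) (auto simp: add.assoc add.left_commute)

lemma cube_automorphism_cube_sym: "cube_automorphism (cube_sym s a b)"
proof -
  have "inj (cube_sym s a b)"
    using cube_sym_inverse by (metis injI)
  moreover have "finite (UNIV :: point set)"
    unfolding UNIV_point by simp
  ultimately have "bij (cube_sym s a b)"
    by (simp add: bij_def finite_UNIV_inj_surj)
  moreover have "cube_adj (cube_sym s a b q) (cube_sym s a b q') = cube_adj q q'" for q q'
    by (cases q; cases q'; cases s;
        simp only: cube_sym.simps cube_adj.simps add_right_cancel if_True if_False; simp only: ac_simps)
  ultimately show ?thesis unfolding cube_automorphism_def by blast
qed

text \<open>An injective self-map of a finite family is onto, so closure in one direction gives the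
  equivalence.\<close>

lemma image_mem_iff_if_closed:
  assumes "finite F" "inj f" "\<And>S. S \<in> F \<Longrightarrow> f ` S \<in> F"
  shows "f ` S \<in> F \<longleftrightarrow> S \<in> F"
proof
  have "image f ` F = F"
    using assms by (intro endo_inj_surj) (auto simp: inj_on_def inj_image_eq_iff)
  then show "S \<in> F" if "f ` S \<in> F"
    using that assms(2) by (metis imageE inj_image_eq_iff)
qed (rule assms(3))

lemma cube_sym_faces: "cube_sym s a b ` S \<in> faces \<longleftrightarrow> S \<in> faces"
proof (rule image_mem_iff_if_closed)
  show "inj (cube_sym s a b)"
    by (rule cube_automorphismD(2)[OF cube_automorphism_cube_sym])
  show "finite faces" unfolding faces_code by simp
  have "\<forall>S\<in>faces. cube_sym s a b ` S \<in> faces"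
    unfolding faces_code by (cases s; cases a; cases b; simp only:; code_simp)
  then show "cube_sym s a b ` S \<in> faces" if "S \<in> faces" for S using that by blast
qed

text \<open>The symmetries preserve adjacency and commute with \<open>antipode\<close>, and edge
  planes are defined from these two notions alone.\<close>

lemma cube_sym_edge_planes: "cube_sym s a b ` S \<in> edge_planes \<longleftrightarrow> S \<in> edge_planes"
proof (rule image_mem_iff_if_closed)
  show "inj (cube_sym s a b)"
    by (rule cube_automorphismD(2)[OF cube_automorphism_cube_sym])
  show "finite edge_planes" unfolding edge_planes_code by simp
  have anti: "cube_sym s a b (antipode q) = antipode (cube_sym s a b q)" for q
    by (cases q; cases s; simp only: cube_sym.simps antipode.simps if_True if_False ac_simps)
  show "cube_sym s a b ` S \<in> edge_planes" if "S \<in> edge_planes" for S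
  proof -
    from that obtain q q' where q: "cube_adj q q'" and S: "S = {q, q', antipode q, antipode q'}"
      by (auto simp: edge_planes_def simp del: split_paired_Ex)
    have "cube_sym s a b ` S = {cube_sym s a b q, cube_sym s a b q',
        antipode (cube_sym s a b q), antipode (cube_sym s a b q')}"
      by (simp add: S anti)
    moreover have "cube_adj (cube_sym s a b q) (cube_sym s a b q')"
      using q cube_automorphismD(4)[OF cube_automorphism_cube_sym] by blast
    ultimately show ?thesis unfolding edge_planes_def by blast
  qed
qed

text \<open>Each of the three classes of planes is preserved; for non-adjacent planes, cardinality
  and adjacency are what matters.\<close>

lemma cube_sym_affine_planes: "cube_sym s a b ` S \<in> affine_planes \<longleftrightarrow> S \<in> affine_planes"
proof -
  note aut = cube_automorphismD[OF cube_automorphism_cube_sym, of s a b]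
  have "card (cube_sym s a b ` S) = card S"
    using aut(2) by (intro card_image) (rule inj_on_subset, auto)
  then have "cube_sym s a b ` S \<in> nonadjacent_planes \<longleftrightarrow> S \<in> nonadjacent_planes"
    unfolding nonadjacent_planes_def mem_Collect_eq ball_simps(9) aut(4) by simp
  then show ?thesis
    by (simp add: affine_planes_eq cube_sym_faces cube_sym_edge_planes)
qed

section \<open>Relabelling C by symmetries that preserve B_1 to B_5\<close>

definition permute :: "nat list \<Rightarrow> int list list \<Rightarrow> int list list" where
  "permute ps cs = map (\<lambda>j. map (\<lambda>i. cs ! j ! i) ps) ps"

definition preserved :: "nat list \<Rightarrow> int list list \<Rightarrow> bool" where
  "preserved ps cs \<longleftrightarrow> permute ps cs = cs"

definition cube_sym_perm :: "bool \<Rightarrow> bit \<Rightarrow> bit \<Rightarrow> nat list" where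
  "cube_sym_perm s a b = map (\<lambda>q. point_index (cube_sym s a b q)) points"

lemma preserved_B: "\<forall>es\<in>set (take 5 B_edges). preserved (cube_sym_perm s a b) (edge_cols es)"
  unfolding B_edges_def by (cases s; cases a; cases b; simp; intro conjI; code_simp)

lemma B_mat_cube_sym:
  assumes k: "k \<in> {1..5}"
  shows "B_mat k $$ (point_index (cube_sym s a b q), point_index (cube_sym s a b q')) =
    B_mat k $$ (point_index q, point_index q')"
proof -
  let ?cs = "edge_cols (B_edges ! (k - 1))"
  have "permute (cube_sym_perm s a b) ?cs = ?cs"
    using preserved_B B_edges_nth_mem(1)[OF k] by (auto simp: preserved_def)
  then have "?cs ! point_index q' ! point_index q =
      permute (cube_sym_perm s a b) ?cs ! point_index q' ! point_index q" by simp
  also have "\<dots> = ?cs ! point_index (cube_sym s a b q') ! point_index (cube_sym s a b q)"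
    using point_index_less by (simp add: permute_def cube_sym_perm_def)
  finally show ?thesis using point_index_less by (simp add: B_mat_nth)
qed

lemma nbhd_comp:
  assumes "bij \<tau>"
  shows "nbhd \<Gamma> p v = \<tau> ` nbhd \<Gamma> (p \<circ> \<tau>) v"
proof -
  have "nbhd \<Gamma> (p \<circ> \<tau>) v = \<tau> -` nbhd \<Gamma> p v" by (auto simp: nbhd_def)
  then show ?thesis using assms by (simp add: surj_image_vimage_eq bij_is_surj)
qed

text \<open>\<tau> intertwines \<pi>' with \<pi> and respects the classes of planes, so both
  labellings change outside neighbourhoods alike. Inside C nothing changes, because of
  \<open>fixed\<close>.\<close>

lemma switch_conj:
  assumes graph: "pair_graph \<Gamma>" and inj: "inj p" and C: "range p \<subseteq> pverts \<Gamma>"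
    and conj: "\<pi> \<circ> \<tau> = \<tau> \<circ> \<pi>'" and \<tau>: "bij \<tau>"
    and faces: "\<And>S. \<tau> ` S \<in> faces \<longleftrightarrow> S \<in> faces"
    and edge_planes: "\<And>S. \<tau> ` S \<in> edge_planes \<longleftrightarrow> S \<in> edge_planes"
    and M: "adjacency_mat \<Gamma> (map p points) = M" "adjacency_mat \<Gamma> (map (p \<circ> \<tau>) points) = M"
    and fixed: "switched_B M = M"
  shows "switch \<Gamma> (p \<circ> \<tau>) \<pi>' = switch \<Gamma> p \<pi>"
proof -
  have rng: "range (p \<circ> \<tau>) = range p"
    using \<tau> by (metis bij_is_surj image_comp)
  have inj': "inj (p \<circ> \<tau>)" using inj \<tau> by (simp add: inj_compose bij_is_inj)
  note nbhd = nbhd_comp[OF \<tau>, of \<Gamma> p]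
  have "\<pi> ` \<tau> ` S = \<tau> ` \<pi>' ` S" for S
    unfolding image_comp conj ..
  then have sw: "switched_nbhd \<pi> (\<tau> ` S) = \<tau> ` switched_nbhd \<pi>' S" for S
    using \<tau> by (simp add: switched_nbhd_def faces edge_planes bij_image_Compl_eq flip: Compl_eq_Diff_UNIV)
  have mem: "q \<in> \<tau> ` S \<longleftrightarrow> inv_into UNIV \<tau> q \<in> S" for q S
    using inj_image_mem_iff[OF bij_is_inj[OF \<tau>], of "inv_into UNIV \<tau> q" S]
      surj_f_inv_f[OF bij_is_surj[OF \<tau>], of q] by simp
  have C': "range (p \<circ> \<tau>) \<subseteq> pverts \<Gamma>" using C rng by simp
  note arcs = parcs_switch[OF graph inj C, where \<pi> = \<pi>]
    and arcs' = parcs_switch[OF graph inj' C', where \<pi> = \<pi>', unfolded rng]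
  have inner: "adjacency_mat \<Gamma> (map p points) $$ (point_index a, point_index b) = of_bool ((p a, p b) \<in> parcs \<Gamma>)"
    for p :: "point \<Rightarrow> 'a" and a b
    by (simp add: adjacency_mat_def point_index_less)
  \<comment> \<open>Every labelled vertex is rewritten in the new labelling, so that
    \<open>arcs'\<close> applies to it.\<close>
  have p_eq: "p q = (p \<circ> \<tau>) (inv_into UNIV \<tau> q)" for q
    using \<tau> by (simp add: bij_is_surj surj_f_inv_f)
  have "(u, v) \<in> parcs (switch \<Gamma> (p \<circ> \<tau>) \<pi>') \<longleftrightarrow> (u, v) \<in> parcs (switch \<Gamma> p \<pi>)"
    if uv: "u \<in> pverts \<Gamma>" "v \<in> pverts \<Gamma>" for u v
  proof (cases "u \<in> range p"; cases "v \<in> range p")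
    assume "u \<in> range p" "v \<in> range p"
    then obtain a b where ab: "u = p a" "v = p b" by auto
    have "(u, v) \<in> parcs (switch \<Gamma> p \<pi>) \<longleftrightarrow> (u, v) \<in> parcs \<Gamma>"
      unfolding ab arcs(1) M(1) fixed by (simp add: inner flip: M(1))
    moreover have "(u, v) \<in> parcs (switch \<Gamma> (p \<circ> \<tau>) \<pi>') \<longleftrightarrow> (u, v) \<in> parcs \<Gamma>"
      unfolding ab p_eq[of a] p_eq[of b] arcs'(1) M(2) fixed by (simp add: inner flip: M(2))
    ultimately show ?thesis by simp
  next
    assume "u \<in> range p" "v \<notin> range p"
    then obtain a where a: "u = p a" and v: "v \<in> pverts \<Gamma> - range p" using uv by auto
    have "(u, v) \<in> parcs (switch \<Gamma> p \<pi>) \<longleftrightarrow> a \<in> \<tau> ` switched_nbhd \<pi>' (nbhd \<Gamma> (p \<circ> \<tau>) v)"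
      unfolding a arcs(3)[OF v] nbhd sw ..
    then show ?thesis unfolding a p_eq[of a] arcs'(3)[OF v] mem by simp
  next
    assume "u \<notin> range p" "v \<in> range p"
    then obtain a where a: "v = p a" and u: "u \<in> pverts \<Gamma> - range p" using uv by auto
    have "(u, v) \<in> parcs (switch \<Gamma> p \<pi>) \<longleftrightarrow> a \<in> \<tau> ` switched_nbhd \<pi>' (nbhd \<Gamma> (p \<circ> \<tau>) u)"
      unfolding a arcs(2)[OF u] nbhd sw ..
    then show ?thesis unfolding a p_eq[of a] arcs'(2)[OF u] mem by simp
  next
    assume "u \<notin> range p" "v \<notin> range p"
    then show ?thesis using uv arcs(4) arcs'(4) by simp
  qed
  then have "parcs (switch \<Gamma> (p \<circ> \<tau>) \<pi>') = parcs (switch \<Gamma> p \<pi>)"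
    using arcs(5) arcs'(5) by auto
  then show ?thesis by (simp add: switch_def)
qed

lemma cube_automorphism_comp:
  assumes "cube_automorphism f" "cube_automorphism g"
  shows "cube_automorphism (f \<circ> g)"
  unfolding cube_automorphism_def comp_apply assms[THEN cube_automorphismD(4)]
  using bij_comp[OF assms(2,1)[THEN cube_automorphismD(1)]] by (simp add: comp_def)

text \<open>Both automorphisms are conjugate to \<open>rot_antipode\<close>; one conjugating map is
  composed with the inverse of the other.\<close>

lemma order_six_conjugate:
  assumes "order_six_automorphism \<pi>" "order_six_automorphism \<pi>'"
  shows "\<exists>\<tau>. cube_automorphism \<tau> \<and> \<pi>' \<circ> \<tau> = \<tau> \<circ> \<pi>"
proof -
  obtain s a b where \<pi>: "\<pi> \<circ> cube_sym s a b = cube_sym s a b \<circ> rot_antipode"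
    using order_six_conj[OF assms(1)] by blast
  obtain s' a' b' where \<pi>': "\<pi>' \<circ> cube_sym s' a' b' = cube_sym s' a' b' \<circ> rot_antipode"
    using order_six_conj[OF assms(2)] by blast
  define g where "g = cube_sym s a (if s then a + b else b)"
  have g: "g (cube_sym s a b q) = q" for q
    unfolding g_def by (rule cube_sym_inverse)
  have "surj (cube_sym s a b)"
    by (rule cube_automorphismD(3)[OF cube_automorphism_cube_sym])
  then have g': "cube_sym s a b (g q) = q" for q
    using g by (metis surjD)
  have "rot_antipode (g q) = g (\<pi> q)" for q
    using fun_cong[OF \<pi>, of "g q"] g g' by (metis comp_apply)
  then have "\<pi>' (cube_sym s' a' b' (g q)) = cube_sym s' a' b' (g (\<pi> q))" for q
    using fun_cong[OF \<pi>', of "g q"] by simp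
  then have "\<pi>' \<circ> (cube_sym s' a' b' \<circ> g) = (cube_sym s' a' b' \<circ> g) \<circ> \<pi>"
    by auto
  moreover have "cube_automorphism (cube_sym s' a' b' \<circ> g)"
    unfolding g_def by (intro cube_automorphism_comp cube_automorphism_cube_sym)
  ultimately show ?thesis by blast
qed

theorem theorem31:
  fixes \<Gamma> :: "'a pair_pre_digraph"
    and p :: "point \<Rightarrow> 'a"
    and \<pi> :: "point \<Rightarrow> point"
  assumes graph: "pair_graph \<Gamma>"
    and inj: "inj p"
    and C: "range p \<subseteq> pverts \<Gamma>"
    and i: "\<exists>k\<in>{1..40}. adjacency_mat \<Gamma> (map p points) = B_mat k"
    and ii: "\<And>v. v \<in> pverts \<Gamma> - range p \<Longrightarrow>
               nbhd \<Gamma> p v = UNIV \<or> nbhd \<Gamma> p v = {} \<or> nbhd \<Gamma> p v \<in> affine_planes"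
    and order_six: "order_six_automorphism \<pi>"
    and matching: "\<exists>k\<in>{6..40}. adjacency_mat \<Gamma> (map p points) = B_mat k \<Longrightarrow> realised_by_R_cube \<pi>"
  shows "pair_graph (switch \<Gamma> p \<pi>) \<and>
         adjacency_mat (switch \<Gamma> p \<pi>) (map p points) = switched_B (adjacency_mat \<Gamma> (map p points)) \<and>
         R_cospectral \<Gamma> (switch \<Gamma> p \<pi>) \<and>
         (\<forall>\<pi>'. order_six_automorphism \<pi>' \<longrightarrow>
            (\<exists>\<tau>. cube_automorphism \<tau> \<and> \<pi>' \<circ> \<tau> = \<tau> \<circ> \<pi>))"
proof -
  define M where "M = adjacency_mat \<Gamma> (map p points)"
  have "pair_graph (switch \<Gamma> p \<pi>) \<and>
    adjacency_mat (switch \<Gamma> p \<pi>) (map p points) = switched_B M \<and>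
    R_cospectral \<Gamma> (switch \<Gamma> p \<pi>)"
  proof (cases "\<exists>k\<in>{6..40}. M = B_mat k")
    case True
    then obtain k where k: "k \<in> {6..40}" "M = B_mat k" by blast
    have N: "switched_B M = transpose_mat R_cube * M * R_cube"
      using True by (simp add: switched_B_def)
    have real: "realised_by_R_cube \<pi>" using matching True unfolding M_def by blast
    show ?thesis
    proof (rule switch_realised[OF graph inj C ii real M_def N])
      show "switched_B M $$ (i, j) = 0 \<or> switched_B M $$ (i, j) = 1" if "i < 8" "j < 8" for i j
        unfolding N unfolding k(2) by (rule conj_B_mat_graph(1)[OF k(1) that])
      show "switched_B M $$ (i, i) = 0" if "i < 8" for i
        unfolding N unfolding k(2) by (rule conj_B_mat_graph(2)[OF k(1) that that])
    qed
  next
    case False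
    then have fixed: "switched_B M = M" by (simp add: switched_B_def)
    from i obtain k where "k \<in> {1..40}" and "M = B_mat k"
      unfolding M_def by blast
    moreover from this False have "k \<notin> {6..40}" by blast
    ultimately have k: "k \<in> {1..5}" "M = B_mat k" by auto
    \<comment> \<open>Here \<pi> need not be the realised automorphism, so C is relabelled to
      replace it by \<open>rot_antipode\<close>.\<close>
    obtain s a b where conj: "\<pi> \<circ> cube_sym s a b = cube_sym s a b \<circ> rot_antipode"
      using order_six_conj[OF order_six] by blast
    define \<tau> where "\<tau> = cube_sym s a b"
    have \<tau>: "bij \<tau>"
      unfolding \<tau>_def by (rule cube_automorphismD(1)[OF cube_automorphism_cube_sym])
    have rng: "range (p \<circ> \<tau>) = range p"
      using \<tau> by (metis bij_is_surj image_comp)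
    have inj': "inj (p \<circ> \<tau>)" using inj \<tau> by (simp add: inj_compose bij_is_inj)
    \<comment> \<open>The relabelling permutes rows and columns by a symmetry of the induced
      graph.\<close>
    have M': "M = adjacency_mat \<Gamma> (map (p \<circ> \<tau>) points)"
    proof (rule eq_matI)
      fix i j assume "i < dim_row (adjacency_mat \<Gamma> (map (p \<circ> \<tau>) points))"
        "j < dim_col (adjacency_mat \<Gamma> (map (p \<circ> \<tau>) points))"
      then have ij: "i < 8" "j < 8" by (auto simp: adjacency_mat_def)
      then have "adjacency_mat \<Gamma> (map (p \<circ> \<tau>) points) $$ (i, j) =
          M $$ (point_index (\<tau> (points ! i)), point_index (\<tau> (points ! j)))"
        by (simp add: M_def adjacency_mat_def point_index_less)
      also have "\<dots> = M $$ (i, j)"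
        unfolding k(2) \<tau>_def B_mat_cube_sym[OF k(1)] using ij by simp
      finally show "M $$ (i, j) = adjacency_mat \<Gamma> (map (p \<circ> \<tau>) points) $$ (i, j)" ..
    qed (auto simp: M_def adjacency_mat_def)
    have switch: "switch \<Gamma> (p \<circ> \<tau>) rot_antipode = switch \<Gamma> p \<pi>"
      by (rule switch_conj[OF graph inj C conj[folded \<tau>_def] \<tau> _ _ M_def[symmetric] M'[symmetric] fixed])
        (simp_all add: \<tau>_def cube_sym_faces cube_sym_edge_planes)
    have ii': "nbhd \<Gamma> (p \<circ> \<tau>) v = UNIV \<or> nbhd \<Gamma> (p \<circ> \<tau>) v = {} \<or> nbhd \<Gamma> (p \<circ> \<tau>) v \<in> affine_planes"
      if "v \<in> pverts \<Gamma> - range (p \<circ> \<tau>)" for v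
    proof -
      have "nbhd \<Gamma> p v = \<tau> ` nbhd \<Gamma> (p \<circ> \<tau>) v"
        by (rule nbhd_comp[OF \<tau>])
      moreover have "\<tau> ` S = UNIV \<longleftrightarrow> S = UNIV" for S
        using \<tau> by (metis bij_is_inj bij_is_surj inj_image_eq_iff)
      ultimately show ?thesis
        using ii[of v] that unfolding rng by (simp add: \<tau>_def cube_sym_affine_planes)
    qed
    have M_01: "M $$ (i, j) = 0 \<or> M $$ (i, j) = 1" if "i < 8" "j < 8" for i j
      using that by (simp add: k(2) B_mat_def)
    have M_diag: "M $$ (i, i) = 0" if "i < 8" for i
    proof -
      interpret pair_graph \<Gamma> by (rule graph)
      show ?thesis using that pair_no_loops[of "(p (points ! i), p (points ! i))"]
        by (auto simp: M_def adjacency_mat_def)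
    qed
    have "pair_graph (switch \<Gamma> p \<pi>) \<and> R_cospectral \<Gamma> (switch \<Gamma> p \<pi>)"
      using switch_realised[OF graph inj' C[folded rng] ii' realised_rot_antipode M', unfolded switch fixed]
        conj_B_mat_fixed[OF k(1)] k(2) M_01 M_diag by simp
    \<comment> \<open>\<open>switch_realised\<close> was applied to the labelling
      \<open>p \<circ> \<tau>\<close>; the matrix is needed for the labelling
      \<open>p\<close>.\<close>
    moreover have "adjacency_mat (switch \<Gamma> p \<pi>) (map p points) = M"
      by (rule adjacency_mat_switch[OF graph inj C])
        (use M_01 fixed in \<open>auto simp flip: M_def, auto simp: M_def adjacency_mat_def\<close>)
    ultimately show ?thesis by (simp add: fixed)
  qed
  then show ?thesis
    using order_six_conjugate[OF order_six] by (simp add: M_def)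
qed

end
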